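(* Let $p,q\ge1$ be integers. A generic fiber of $X_{(p,q)}\to\mathbb D$ and the base $A_\Omega$ of the mirror conic fibration (the SYZ mirror of $X_{(p,q)}$) are mirror symmetric.
   Context: Abelian surfaces $A$ and $A'$ are called mirror symmetric if $NS(A)\oplus U\cong T(A')$ as lattices (and thus $NS(A')\oplus U\cong T(A)$), where $NS$ is the Néron--Severi lattice, $T$ the transcendental lattice, and $U$ the hyperbolic lattice with Gram matrix $\begin{pmatrix}0&1\\1&0\end{pmatrix}$. $X_{(p,q)}$ is a crepant resolution of the fiber product over the disc $\mathbb D$ of the local elliptic surfaces $\widetilde A_{p-1}$ and $\widetilde A_{q-1}$ (elliptic fibrations over $\mathbb D$, each with one singular fiber, over $0$, of type $I_p$, resp. $I_q$). Concretely, it is the quotient by $p\mathbb Z\times q\mathbb Z$ (acting by translation on the first two coordinates) of a neighborhood of the toric divisors in the toric Calabi--Yau 3-fold of infinite type whose fan consists of the cones over the triangles with vertices $(i,j,1),(i+1,j,1),(i,j+1,1)$ and $(i+1,j,1),(i,j+1,1),(i+1,j+1,1)$, $i,j\in\mathbb Z$. The natural map $X_{(p,q)}\to\mathbb D$ is an abelian surface fibration whose fiber over $t\ne0$ is $(\mathbb C^\times/t^{p\mathbb Z})\times(\mathbb C^\times/t^{q\mathbb Z})$. Let $C^1_{(a,b)},C^2_{(a,b)},C^3_{(a,b)}$ be the toric rational curves corresponding to the 2-dimensional cones over the edges joining $(a+1,b,1)$ to $(a,b+1,1)$, $(a,b,1)$ to $(a,b+1,1)$, and $(a,b,1)$ to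 $(a+1,b,1)$ respectively, and let $\sigma_{(a,b)},\tau_{(a,b)},\rho_{(a,b)}$ be the complexified Kähler parameters of the classes $C^1_{(a,b)}$, $C^1_{(a,b)}+C^2_{(a,b)}$, $C^1_{(a,b)}+C^3_{(a,b)}$. Put $\tau=\sum_{k=0}^{p-1}\tau_{(k,b)}$, $\rho=\sum_{l=0}^{q-1}\rho_{(a,l)}$, $\sigma=\sum_{k=0}^{p-1}\sum_{l=0}^{q-1}\sigma_{(k,l)}$ (independent of $a,b$). The SYZ mirror of $X_{(p,q)}$ is a conic fibration over the $(p,q)$-polarized abelian surface $A_\Omega$ with period $\Omega=\begin{bmatrix}p\tau&\sigma\\ \sigma&q\rho\end{bmatrix}$, which lies in the Siegel upper half-plane; that is, $A_\Omega=(\mathbb C^\times)^2/\mathbb Z^2$ where the generators of $\mathbb Z^2$ act by $(X,Y)\mapsto(e^{2\pi i\tau}X,e^{2\pi i\sigma/p}Y)$ and $(X,Y)\mapsto(e^{2\pi i\sigma/q}X,e^{2\pi i\rho}Y)$.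
   Formalization: Besides a generic fiber (t outside a countable set), the parameters (τ,σ,ρ) of A_Ω must be very general (outside a countable union of proper analytic subsets); for special Ω, e.g. p=q=1, τ=ρ=2i, σ=i, NS(A_Ω) is too large and the claim fails. *)

theory Defs
  imports "HOL-Analysis.Analysis"
begin

section \<open>Lattices\<close>

record 'a lat =
  pts :: "'a set"
  form :: "'a \<Rightarrow> 'a \<Rightarrow> real"

definition lat_iso :: "'a::ab_group_add lat \<Rightarrow> 'b::ab_group_add lat \<Rightarrow> bool" where
  "lat_iso L M \<longleftrightarrow> (\<exists>f. bij_betw f (pts L) (pts M) \<and>
     (\<forall>x\<in>pts L. \<forall>y\<in>pts L. f (x + y) = f x + f y \<and> form M (f x) (f y) = form L x y))"

definition lat_sum :: "'a lat \<Rightarrow> 'b lat \<Rightarrow> ('a \<times> 'b) lat" where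
  "lat_sum L M = \<lparr> pts = pts L \<times> pts M,
     form = (\<lambda>x y. form L (fst x) (fst y) + form M (snd x) (snd y)) \<rparr>"

definition hyperbolic_lat :: "(int \<times> int) lat" where
  "hyperbolic_lat = \<lparr> pts = UNIV,
     form = (\<lambda>x y. of_int (fst x * snd y + snd x * fst y)) \<rparr>"


section \<open>Complex tori of dimension two and their second cohomology\<close>

text \<open>A torus is given by its period lattice in \<open>\<complex>\<^sup>2\<close>. An element of \<open>H\<^sup>2(\<complex>\<^sup>2/\<Lambda>, \<real>)\<close> is the
  constant 2-form representing it, i.e. an alternating real-bilinear form on \<open>\<complex>\<^sup>2\<close>; the integral
  classes are those taking integer values on the period lattice.\<close>

type_synonym two_form = "(complex^2) \<Rightarrow>\<^sub>L (complex^2) \<Rightarrow>\<^sub>L real"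

abbreviation ev :: "two_form \<Rightarrow> complex^2 \<Rightarrow> complex^2 \<Rightarrow> real" where
  "ev E v w \<equiv> blinfun_apply (blinfun_apply E v) w"

definition H2 :: "(complex^2) set \<Rightarrow> two_form set" where
  "H2 \<Lambda> = {E. (\<forall>v. ev E v v = 0) \<and> (\<forall>x\<in>\<Lambda>. \<forall>y\<in>\<Lambda>. ev E x y \<in> \<int>)}"

definition wedge ::
  "('v \<Rightarrow> 'v \<Rightarrow> real) \<Rightarrow> ('v \<Rightarrow> 'v \<Rightarrow> real) \<Rightarrow> (nat \<Rightarrow> 'v) \<Rightarrow> real" where
  "wedge E F b =
     E (b 0) (b 1) * F (b 2) (b 3) - E (b 0) (b 2) * F (b 1) (b 3) + E (b 0) (b 3) * F (b 1) (b 2)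
   + E (b 1) (b 2) * F (b 0) (b 3) - E (b 1) (b 3) * F (b 0) (b 2) + E (b 2) (b 3) * F (b 0) (b 1)"

text \<open>The form \<open>dx\<^sub>1 \<and> dy\<^sub>1 + dx\<^sub>2 \<and> dy\<^sub>2\<close>, where \<open>z\<^sub>k = x\<^sub>k + i y\<^sub>k\<close>; its square is twice the volume form
  defining the complex orientation.\<close>

definition kaehler0 :: "complex^2 \<Rightarrow> complex^2 \<Rightarrow> real" where
  "kaehler0 v w = (\<Sum>k\<in>UNIV. Re (v $ k) * Im (w $ k) - Im (v $ k) * Re (w $ k))"

text \<open>The positivity condition says both that \<open>b\<close> is a real basis of \<open>\<complex>\<^sup>2\<close> and that it is
  positively oriented.\<close>

definition oriented_basis :: "(complex^2) set \<Rightarrow> (nat \<Rightarrow> complex^2) \<Rightarrow> bool" where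
  "oriented_basis \<Lambda> b \<longleftrightarrow>
     \<Lambda> = {\<Sum>i<4. of_int (n i) *\<^sub>R b i | n :: nat \<Rightarrow> int. True} \<and> wedge kaehler0 kaehler0 b > 0"

text \<open>The cup product evaluated on the fundamental class, i.e. the integral of the 4-form over a
  fundamental parallelotope. It does not depend on the chosen oriented basis.\<close>

definition intersection :: "(complex^2) set \<Rightarrow> two_form \<Rightarrow> two_form \<Rightarrow> real" where
  "intersection \<Lambda> E F =
     wedge (ev E) (ev F) (SOME b. oriented_basis \<Lambda> b)"

text \<open>\<open>NS = H\<^sup>2(A, \<int>) \<inter> H\<^sup>1\<^sup>,\<^sup>1(A)\<close>: a real 2-form has type (1,1) iff it is invariant under
  multiplication by \<open>i\<close>.\<close>

definition NS_set :: "(complex^2) set \<Rightarrow> two_form set" where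
  "NS_set \<Lambda> = {E \<in> H2 \<Lambda>. \<forall>v w. ev E (\<i> *s v) (\<i> *s w) = ev E v w}"

definition NS :: "(complex^2) set \<Rightarrow> two_form lat" where
  "NS \<Lambda> = \<lparr> pts = NS_set \<Lambda>, form = intersection \<Lambda> \<rparr>"

definition T :: "(complex^2) set \<Rightarrow> two_form lat" where
  "T \<Lambda> = \<lparr> pts = {E \<in> H2 \<Lambda>. \<forall>F\<in>NS_set \<Lambda>. intersection \<Lambda> E F = 0}, form = intersection \<Lambda> \<rparr>"

text \<open>The second condition is the existence of a polarization.\<close>

definition abelian_surface :: "(complex^2) set \<Rightarrow> bool" where
  "abelian_surface \<Lambda> \<longleftrightarrow>
     (\<exists>b. oriented_basis \<Lambda> b) \<and> (\<exists>E\<in>NS_set \<Lambda>. \<forall>v. v \<noteq> 0 \<longrightarrow> ev E v (\<i> *s v) > 0)"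

definition mirror_symmetric :: "(complex^2) set \<Rightarrow> (complex^2) set \<Rightarrow> bool" where
  "mirror_symmetric \<Lambda> \<Lambda>' \<longleftrightarrow> abelian_surface \<Lambda> \<and> abelian_surface \<Lambda>' \<and>
     lat_iso (lat_sum (NS \<Lambda>) hyperbolic_lat) (T \<Lambda>') \<and>
     lat_iso (lat_sum (NS \<Lambda>') hyperbolic_lat) (T \<Lambda>)"


section \<open>The fibers and the base of the mirror\<close>

text \<open>The period lattice of \<open>(\<complex>\<^sup>\<times>)\<^sup>2/\<Gamma>\<close>, with universal covering
  \<open>z \<mapsto> (exp (2\<pi>i z\<^sub>1), exp (2\<pi>i z\<^sub>2))\<close>.  \<open>X_fiber p q t\<close> is the fiber over \<open>t \<noteq> 0\<close>.\<close>

definition period_lattice :: "(complex \<times> complex) set \<Rightarrow> (complex^2) set" where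
  "period_lattice \<Gamma> = {z. (exp (2 * of_real pi * \<i> * z $ 1), exp (2 * of_real pi * \<i> * z $ 2)) \<in> \<Gamma>}"

definition X_fiber :: "nat \<Rightarrow> nat \<Rightarrow> complex \<Rightarrow> (complex^2) set" where
  "X_fiber p q t =
     period_lattice {(t powi (int p * m), t powi (int q * n)) | m n :: int. True}"

definition A_base :: "nat \<Rightarrow> nat \<Rightarrow> complex \<Rightarrow> complex \<Rightarrow> complex \<Rightarrow> (complex^2) set" where
  "A_base p q \<tau> \<sigma> \<rho> = period_lattice
     {(exp (2 * of_real pi * \<i> * \<tau>) powi m * exp (2 * of_real pi * \<i> * \<sigma> / of_nat q) powi n,
       exp (2 * of_real pi * \<i> * \<sigma> / of_nat p) powi m * exp (2 * of_real pi * \<i> * \<rho>) powi n)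
      | m n :: int. True}"

text \<open>\<open>c1 a b\<close>, \<open>c2 a b\<close>, \<open>c3 a b\<close> are the complexified Kaehler parameters of the toric curves
  \<open>C\<^sup>1\<close>, \<open>C\<^sup>2\<close>, \<open>C\<^sup>3\<close> with index \<open>(a,b)\<close>. They are invariant under the action of \<open>p\<int> \<times> q\<int>\<close>, and
  respect the two toric relations between the six curves on the compact divisor of each vertex
  \<open>(a,b,1)\<close>: the sum of the curve classes, weighted by the directions (1,0), (0,1), (-1,0), (0,-1),
  (1,-1), (-1,1) of the corresponding edges, vanishes.\<close>

definition kaehler_parameters :: "nat \<Rightarrow> nat \<Rightarrow>
    (int \<Rightarrow> int \<Rightarrow> complex) \<Rightarrow> (int \<Rightarrow> int \<Rightarrow> complex) \<Rightarrow> (int \<Rightarrow> int \<Rightarrow> complex) \<Rightarrow> bool" where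
  "kaehler_parameters p q c1 c2 c3 \<longleftrightarrow>
     (\<forall>c\<in>{c1, c2, c3}. \<forall>a b. c (a + int p) b = c a b \<and> c a (b + int q) = c a b \<and> Im (c a b) > 0) \<and>
     (\<forall>a b. c3 a b + c1 a (b - 1) = c3 (a - 1) b + c1 (a - 1) b) \<and>
     (\<forall>a b. c2 a b + c1 (a - 1) b = c2 a (b - 1) + c1 a (b - 1))"

definition tau_param :: "nat \<Rightarrow> (int \<Rightarrow> int \<Rightarrow> complex) \<Rightarrow> (int \<Rightarrow> int \<Rightarrow> complex) \<Rightarrow> int \<Rightarrow> complex" where
  "tau_param p c1 c2 b = (\<Sum>k<p. c1 (int k) b + c2 (int k) b)"

definition rho_param :: "nat \<Rightarrow> (int \<Rightarrow> int \<Rightarrow> complex) \<Rightarrow> (int \<Rightarrow> int \<Rightarrow> complex) \<Rightarrow> int \<Rightarrow> complex" where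
  "rho_param q c1 c3 a = (\<Sum>l<q. c1 a (int l) + c3 a (int l))"

definition sigma_param :: "nat \<Rightarrow> nat \<Rightarrow> (int \<Rightarrow> int \<Rightarrow> complex) \<Rightarrow> complex" where
  "sigma_param p q c1 = (\<Sum>k<p. \<Sum>l<q. c1 (int k) (int l))"


section \<open>Genericity\<close>

definition siegel_upper_half :: "(complex^'g^'g) set" where
  "siegel_upper_half = {\<Omega>. transpose \<Omega> = \<Omega> \<and>
     (\<forall>v :: real^'g. v \<noteq> 0 \<longrightarrow> v \<bullet> ((\<chi> i j. Im (\<Omega> $ i $ j)) *v v) > 0)}"

text \<open>The coordinates are \<open>\<tau>\<close>, \<open>\<sigma>\<close>, \<open>\<rho>\<close>.\<close>

definition period_matrix :: "nat \<Rightarrow> nat \<Rightarrow> complex^3 \<Rightarrow> complex^2^2" where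
  "period_matrix p q x =
     vector [vector [of_nat p * x $ 1, x $ 2], vector [x $ 2, of_nat q * x $ 3]]"

definition period_domain :: "nat \<Rightarrow> nat \<Rightarrow> (complex^3) set" where
  "period_domain p q = {x. period_matrix p q x \<in> siegel_upper_half}"

definition holomorphic_several :: "(complex^'n \<Rightarrow> complex) \<Rightarrow> (complex^'n) set \<Rightarrow> bool" where
  "holomorphic_several f S \<longleftrightarrow>
     (\<forall>x\<in>S. \<exists>D. (f has_derivative D) (at x) \<and> (\<forall>c v. D (c *s v) = c * D v))"

definition analytic_subset :: "(complex^'n) set \<Rightarrow> (complex^'n) set \<Rightarrow> bool" where
  "analytic_subset S Z \<longleftrightarrow> Z \<subseteq> S \<and>
     (\<forall>x\<in>S. \<exists>V \<F>. open V \<and> x \<in> V \<and> V \<subseteq> S \<and> finite \<F> \<and>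
        (\<forall>f\<in>\<F>. holomorphic_several f V) \<and> Z \<inter> V = {y\<in>V. \<forall>f\<in>\<F>. f y = 0})"

text \<open>The complement of the points in very general position of a connected domain \<open>S\<close>.\<close>

definition exceptional_set :: "(complex^'n) set \<Rightarrow> (complex^'n) set \<Rightarrow> bool" where
  "exceptional_set S Z \<longleftrightarrow>
     (\<exists>\<Z>. countable \<Z> \<and> (\<forall>W\<in>\<Z>. analytic_subset S W \<and> W \<noteq> S) \<and> Z = \<Union>\<Z>)"

end

theory Submission
  imports Defs
begin

text \<open>Write \<open>p = g r\<close> and \<open>q = g r'\<close> with \<open>g = gcd(p, q)\<close>, let \<open>U\<close> be the hyperbolic plane and \<open>\<langle>n\<rangle>\<close> the
  lattice of rank one with a generator of square \<open>n\<close>. Both surfaces are quotients of \<open>\<complex>\<^sup>2\<close> by a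
  lattice \<open>\<int>\<^sup>2 + M \<int>\<^sup>2\<close> with \<open>det (Im M) > 0\<close>:
  \<^item> for the fiber over \<open>t = exp (2\<pi>i s)\<close>, \<open>M\<close> is diagonal with entries \<open>p s, q s\<close>, so that the fiber is
    a product of two isogenous elliptic curves;
  \<^item> for the base of the mirror, \<open>M\<close> has the rows \<open>(\<tau>, \<sigma>/q)\<close> and \<open>(\<sigma>/p, \<rho>)\<close>.

  The second integral cohomology of such a torus consists of the integral alternating forms in the
  basis \<open>b = (e\<^sub>1, f\<^sub>1, e\<^sub>2, f\<^sub>2)\<close>, where \<open>e\<^sub>1, e\<^sub>2\<close> is the standard basis and \<open>f\<^sub>1, f\<^sub>2\<close> are the columns of \<open>M\<close>.
  It is \<open>\<int>\<^sup>6\<close> with the form \<open>U\<^sup>3\<close>, the pairing being \<open>E \<and> F\<close> evaluated on \<open>b\<close>. A real class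
  \<open>E\<close> has type (1,1) iff \<open>E \<and> dz\<^sub>1 \<and> dz\<^sub>2 = 0\<close>, which is one integral linear relation between
  \<open>1\<close>, the entries of \<open>M\<close> and \<open>det M\<close> (lemma \<open>class_of_in_NS_iff\<close>). Genericity says that only the relations that
  hold identically in the parameters hold:
  \<^item> for the fiber, when \<open>s\<close> is not a root of an integral quadratic equation, the Neron-Severi lattice is
    \<open>U \<oplus> \<langle>-2 r r'\<rangle>\<close>, with the last summand coming from the minimal isogeny between the two
    curves, and its orthogonal complement is \<open>\<langle>2 r r'\<rangle> \<oplus> U\<close>;
  \<^item> for the base of the mirror, when \<open>(\<tau>, \<sigma>, \<rho>)\<close> satisfies no integral relation between
    \<open>1, \<tau>, \<sigma>, \<rho>, p q \<tau> \<rho> - \<sigma>\<^sup>2\<close>, the Neron-Severi lattice is \<open>\<langle>2 r r'\<rangle>\<close>, generated by the primitive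
    polarization, and its complement is \<open>U \<oplus> \<langle>-2 r r'\<rangle> \<oplus> U\<close>.

  Adding \<open>U\<close> to either Neron-Severi lattice gives the transcendental lattice of the other surface.

  The excluded \<open>t\<close> are the exponentials of the countably many quadratic numbers. The excluded
  parameters form a countable union of zero sets of nonzero polynomials on the period domain. It remains
  to see that the parameters coming from Kaehler parameters lie in that domain. The toric relations make
  \<open>\<tau>\<close> and \<open>\<rho>\<close> independent of the index, so \<open>q \<tau>\<close> is the sum of all \<open>c1\<close> and \<open>c2\<close>, and \<open>p \<rho>\<close> that of all \<open>c1\<close> and
  \<open>c3\<close>. Hence \<open>q Im \<tau>\<close> and \<open>p Im \<rho>\<close> both exceed \<open>Im \<sigma> > 0\<close>, and their product exceeds \<open>(Im \<sigma>)\<^sup>2\<close>.\<close>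

section \<open>Isometries of lattices\<close>

lemma lat_iso_trans:
  assumes "lat_iso L M" "lat_iso M K" shows "lat_iso L K"
proof -
  obtain f g where f: "bij_betw f (pts L) (pts M)"
      "\<And>x y. x \<in> pts L \<Longrightarrow> y \<in> pts L \<Longrightarrow> f (x + y) = f x + f y \<and> form M (f x) (f y) = form L x y"
    and g: "bij_betw g (pts M) (pts K)"
      "\<And>x y. x \<in> pts M \<Longrightarrow> y \<in> pts M \<Longrightarrow> g (x + y) = g x + g y \<and> form K (g x) (g y) = form M x y"
    using assms unfolding lat_iso_def by blast
  have "f x \<in> pts M" if "x \<in> pts L" for x using f(1) that by (rule bij_betwE[rule_format])
  then have "\<forall>x\<in>pts L. \<forall>y\<in>pts L. (g \<circ> f) (x + y) = (g \<circ> f) x + (g \<circ> f) y \<and>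
      form K ((g \<circ> f) x) ((g \<circ> f) y) = form L x y"
    using f(2) g(2) by simp
  then show ?thesis
    unfolding lat_iso_def using bij_betw_trans[OF f(1) g(1)] by blast
qed

text \<open>Additivity of the inverse needs sums of points to be points again, which the type of
  lattices does not guarantee.\<close>

lemma lat_iso_sym:
  assumes "lat_iso L M" and add: "\<And>x y. x \<in> pts L \<Longrightarrow> y \<in> pts L \<Longrightarrow> x + y \<in> pts L"
  shows "lat_iso M L"
proof -
  obtain f where f: "bij_betw f (pts L) (pts M)"
      "\<And>x y. x \<in> pts L \<Longrightarrow> y \<in> pts L \<Longrightarrow> f (x + y) = f x + f y \<and> form M (f x) (f y) = form L x y"
    using assms(1) unfolding lat_iso_def by blast
  let ?g = "inv_into (pts L) f"
  have g: "bij_betw ?g (pts M) (pts L)" by (rule bij_betw_inv_into[OF f(1)])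
  have "?g (u + v) = ?g u + ?g v \<and> form L (?g u) (?g v) = form M u v"
    if uv: "u \<in> pts M" "v \<in> pts M" for u v
  proof -
    have in_L: "?g u \<in> pts L" "?g v \<in> pts L" using g uv by (auto dest: bij_betwE)
    have inv: "f (?g u) = u" "f (?g v) = v"
      using f(1) uv by (auto simp: bij_betw_inv_into_right)
    have "?g (f (?g u + ?g v)) = ?g u + ?g v"
      using f(1) add[OF in_L] by (auto simp: bij_betw_inv_into_left)
    then show ?thesis using f(2)[OF in_L] inv by simp
  qed
  then show ?thesis unfolding lat_iso_def using g by blast
qed

lemma lat_sum_cong_left:
  assumes "lat_iso L M" shows "lat_iso (lat_sum L K) (lat_sum M K)"
proof -
  obtain f where f: "bij_betw f (pts L) (pts M)"
      "\<And>x y. x \<in> pts L \<Longrightarrow> y \<in> pts L \<Longrightarrow> f (x + y) = f x + f y \<and> form M (f x) (f y) = form L x y"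
    using assms unfolding lat_iso_def by blast
  have "bij_betw (map_prod f id) (pts L \<times> pts K) (pts M \<times> pts K)"
    using f(1) by (intro bij_betw_map_prod) auto
  then show ?thesis
    unfolding lat_iso_def lat_sum_def using f(2) by (intro exI[of _ "map_prod f id"]) auto
qed

definition rank_one_lat :: "int \<Rightarrow> int lat" where
  "rank_one_lat n = \<lparr> pts = UNIV, form = (\<lambda>x y. of_int (n * x * y)) \<rparr>"

text \<open>All isometries below start from a model on a full type of integer tuples, so that the
  bijection amounts to injectivity and exhaustion of the target.\<close>

lemma lat_iso_parametrization:
  assumes "pts K = UNIV" "\<And>x y. f x = f y \<Longrightarrow> x = y" "\<And>x. f x \<in> pts L" "\<And>z. z \<in> pts L \<Longrightarrow> \<exists>x. z = f x"
    "\<And>x y. f (x + y) = f x + f y" "\<And>x y. form L (f x) (f y) = form K x y"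
  shows "lat_iso K L"
proof -
  have "bij_betw f (pts K) (pts L)"
    using assms(2-4) unfolding assms(1) bij_betw_def inj_def by blast
  then show ?thesis unfolding lat_iso_def using assms(5,6) by blast
qed

lemma lat_iso_sum_substitute:
  assumes "lat_iso K L" "pts K = UNIV" "lat_iso (lat_sum K H) M"
  shows "lat_iso (lat_sum L H) M"
  by (rule lat_iso_trans[OF lat_sum_cong_left[OF lat_iso_sym[OF assms(1)]] assms(3)])
    (simp add: assms(2))

section \<open>Arithmetic preliminaries\<close>

text \<open>Completing the square: \<open>a\<close> times the form is \<open>(a r + b s)\<^sup>2 + (a c - b\<^sup>2) s\<^sup>2\<close>.\<close>

lemma binary_form_positive_iff:
  fixes a b c :: real
  shows "(\<forall>r s. r \<noteq> 0 \<or> s \<noteq> 0 \<longrightarrow> a * r\<^sup>2 + 2 * b * r * s + c * s\<^sup>2 > 0) \<longleftrightarrow> a > 0 \<and> a * c > b\<^sup>2"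
    (is "?L \<longleftrightarrow> ?R")
proof
  assume L: ?L
  have "a > 0" using L[rule_format, of 1 0] by simp
  moreover have "a * (a * c - b\<^sup>2) > 0"
    using L[rule_format, of "- b" a] \<open>a > 0\<close> by (simp add: algebra_simps power2_eq_square)
  ultimately show ?R by (simp add: zero_less_mult_iff)
next
  assume R: ?R
  show ?L
  proof (intro allI impI)
    fix r s :: real assume rs: "r \<noteq> 0 \<or> s \<noteq> 0"
    have "a * (a * r\<^sup>2 + 2 * b * r * s + c * s\<^sup>2) = (a * r + b * s)\<^sup>2 + (a * c - b\<^sup>2) * s\<^sup>2"
      by (simp add: algebra_simps power2_eq_square)
    also have "\<dots> > 0"
    proof (cases "s = 0")
      case True
      then show ?thesis using rs R by simp
    next
      case False
      then have "(a * c - b\<^sup>2) * s\<^sup>2 > 0" using R by simp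
      then show ?thesis by (meson add_nonneg_pos zero_le_power2)
    qed
    finally show "a * r\<^sup>2 + 2 * b * r * s + c * s\<^sup>2 > 0"
      by (rule zero_less_mult_pos) (use R in simp)
  qed
qed

lemma coprime_proportional:
  fixes r s x y :: int
  assumes "coprime r s" "r \<noteq> 0" "x * r = y * s"
  shows "\<exists>k. x = k * s \<and> y = k * r"
proof -
  have "r dvd y * s" using assms(3) by (metis dvd_triv_right)
  then have "r dvd y" using assms(1) by (simp add: coprime_dvd_mult_left_iff)
  then obtain k where "y = r * k" by (elim dvdE)
  with assms(2,3) show ?thesis by (intro exI[of _ k]) (auto simp: ac_simps)
qed

lemma gcd_cofactors:
  fixes p q :: nat
  assumes "p \<ge> 1" "q \<ge> 1"
  obtains g r r' :: int where "int p = g * r" "int q = g * r'" "g > 0" "r > 0" "r' > 0" "coprime r r'"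
proof (rule that)
  show "int p = int (gcd p q) * int (p div gcd p q)" "int q = int (gcd p q) * int (q div gcd p q)"
    by (simp_all flip: of_nat_mult)
  show "int (gcd p q) > 0" "int (p div gcd p q) > 0" "int (q div gcd p q) > 0"
    using assms by (auto simp: div_greater_zero_iff dvd_imp_le)
  show "coprime (int (p div gcd p q)) (int (q div gcd p q))"
    using assms by (simp add: coprime_int_iff div_gcd_coprime)
qed

section \<open>Products of alternating forms under a change of basis\<close>

lemma alternating_expand:
  fixes E :: "'v::real_vector \<Rightarrow> 'v \<Rightarrow> real"
  assumes "bilinear E" and alt: "\<And>v. E v v = 0"
  shows "E (\<Sum>i<4. r i *\<^sub>R b i) (\<Sum>j<4. s j *\<^sub>R b j) =
      (r 0 * s 1 - r 1 * s 0) * E (b 0) (b 1) + (r 0 * s 2 - r 2 * s 0) * E (b 0) (b 2)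
    + (r 0 * s 3 - r 3 * s 0) * E (b 0) (b 3) + (r 1 * s 2 - r 2 * s 1) * E (b 1) (b 2)
    + (r 1 * s 3 - r 3 * s (1::nat)) * E (b 1) (b 3) + (r 2 * s 3 - r 3 * s 2) * E (b 2) (b 3)"
proof -
  have swap: "E w v = - E v w" for v w
    using alt[of "v + w"] alt[of v] alt[of w]
    by (simp add: bilinear_ladd[OF assms(1)] bilinear_radd[OF assms(1)])
  have "{..<4} = {0, 1, 2, 3::nat}" by auto
  then show ?thesis
    by (simp add: bilinear_ladd[OF assms(1)] bilinear_radd[OF assms(1)]
        bilinear_lmul[OF assms(1)] bilinear_rmul[OF assms(1)] alt
        swap[of "b 0" "b 1"] swap[of "b 0" "b 2"] swap[of "b 0" "b 3"]
        swap[of "b 1" "b 2"] swap[of "b 1" "b 3"] swap[of "b 2" "b 3"] del: One_nat_def)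
      (simp add: algebra_simps)
qed

text \<open>The \<open>2 \<times> 2\<close> minors of coordinate vectors, read as the coordinate 2-forms \<open>dx\<^sub>k \<and> dx\<^sub>l\<close>. Thus
  \<open>wedge (coord_minor 0 1) (coord_minor 2 3) N\<close> is the Laplace expansion along two columns of the
  determinant of the \<open>4 \<times> 4\<close> matrix \<open>N\<close>.\<close>

definition coord_minor :: "nat \<Rightarrow> nat \<Rightarrow> (nat \<Rightarrow> real) \<Rightarrow> (nat \<Rightarrow> real) \<Rightarrow> real" where
  "coord_minor k l r s = r k * s l - r l * s k"

lemma wedge_coord_minor_repeated:
  "wedge (coord_minor i j) (coord_minor i k) N = 0"
  "wedge (coord_minor i j) (coord_minor k j) N = 0"
  "wedge (coord_minor i j) (coord_minor j k) N = 0"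
  "wedge (coord_minor i j) (coord_minor k i) N = 0"
  by (simp_all add: wedge_def coord_minor_def algebra_simps)

text \<open>The signs are those of the permutations that sort the four indices.\<close>

lemma wedge_coord_minor_complementary:
  "wedge (coord_minor 0 2) (coord_minor 1 3) N = - wedge (coord_minor 0 1) (coord_minor 2 3) N"
  "wedge (coord_minor 0 3) (coord_minor 1 2) N = wedge (coord_minor 0 1) (coord_minor 2 3) N"
  "wedge (coord_minor 1 2) (coord_minor 0 3) N = wedge (coord_minor 0 1) (coord_minor 2 3) N"
  "wedge (coord_minor 1 3) (coord_minor 0 2) N = - wedge (coord_minor 0 1) (coord_minor 2 3) N"
  "wedge (coord_minor 2 3) (coord_minor 0 1) N = wedge (coord_minor 0 1) (coord_minor 2 3) N"
  by (simp_all add: wedge_def coord_minor_def algebra_simps)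

lemma wedge_lincomb_left:
  "wedge (\<lambda>v w. e1 * E1 v w + e2 * E2 v w + e3 * E3 v w + e4 * E4 v w + e5 * E5 v w + e6 * E6 v w) F N
   = e1 * wedge E1 F N + e2 * wedge E2 F N + e3 * wedge E3 F N
   + e4 * wedge E4 F N + e5 * wedge E5 F N + e6 * wedge E6 F N"
  by (simp add: wedge_def algebra_simps)

lemma wedge_lincomb_right:
  "wedge F (\<lambda>v w. e1 * E1 v w + e2 * E2 v w + e3 * E3 v w + e4 * E4 v w + e5 * E5 v w + e6 * E6 v w) N
   = e1 * wedge F E1 N + e2 * wedge F E2 N + e3 * wedge F E3 N
   + e4 * wedge F E4 N + e5 * wedge F E5 N + e6 * wedge F E6 N"
  by (simp add: wedge_def algebra_simps)

text \<open>A 4-form in dimension four is multiplied by the determinant of the base change. Expanding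
  \<open>E\<close> and \<open>F\<close> in the coordinate 2-forms leaves only the products of complementary minors, each
  equal to the determinant up to sign.\<close>

lemma wedge_change_basis:
  fixes E F :: "'v::real_vector \<Rightarrow> 'v \<Rightarrow> real"
  assumes E: "bilinear E" "\<And>v. E v v = 0" and F: "bilinear F" "\<And>v. F v v = 0"
    and b': "\<And>i. i < 4 \<Longrightarrow> b' i = (\<Sum>j<4. N i j *\<^sub>R b j)"
  shows "wedge E F b' = wedge (coord_minor 0 1) (coord_minor 2 3) N * wedge E F b"
proof -
  \<comment> \<open>the pullback of a form on the span of \<open>b\<close> to coordinate vectors, in the basis of coordinate 2-forms\<close>
  define pull :: "('v \<Rightarrow> 'v \<Rightarrow> real) \<Rightarrow> (nat \<Rightarrow> real) \<Rightarrow> (nat \<Rightarrow> real) \<Rightarrow> real" where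
    "pull G = (\<lambda>r s. G (b 0) (b 1) * coord_minor 0 1 r s + G (b 0) (b 2) * coord_minor 0 2 r s
      + G (b 0) (b 3) * coord_minor 0 3 r s + G (b 1) (b 2) * coord_minor 1 2 r s
      + G (b 1) (b 3) * coord_minor 1 3 r s + G (b 2) (b 3) * coord_minor 2 3 r s)" for G
  have pull: "G (b' i) (b' j) = pull G (N i) (N j)"
    if "bilinear G" "\<And>v. G v v = 0" "i < 4" "j < 4" for G i j
    unfolding b'[OF that(3)] b'[OF that(4)] alternating_expand[OF that(1,2)] pull_def coord_minor_def
    by (simp only: mult.commute)
  have "wedge E F b' = wedge (pull E) (pull F) N"
    unfolding wedge_def using pull[OF E] pull[OF F] by simp
  also have "\<dots> = wedge (coord_minor 0 1) (coord_minor 2 3) N * wedge E F b"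
    unfolding pull_def wedge_lincomb_left wedge_lincomb_right
      wedge_coord_minor_repeated wedge_coord_minor_complementary
    by (simp add: wedge_def[of E F] algebra_simps)
  finally show ?thesis .
qed

section \<open>Independence of the intersection form from the basis\<close>

lemma bilinear_ev: "bilinear (ev E)"
  by (simp add: bilinear_def linear_iff blinfun.add_left blinfun.add_right blinfun.scaleR_left blinfun.scaleR_right)

lemma bilinear_kaehler0: "bilinear kaehler0"
  by (auto simp: bilinear_def kaehler0_def intro!: linearI
      simp: sum.distrib[symmetric] sum_distrib_left algebra_simps sum_2)

lemma kaehler0_self: "kaehler0 v v = 0"
  by (simp add: kaehler0_def mult.commute)

lemma oriented_basis_mem:
  assumes "oriented_basis \<Lambda> b" "i < 4" shows "b i \<in> \<Lambda>"
proof -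
  have "b i = (\<Sum>j<4. of_int (if j = i then 1 else 0) *\<^sub>R b j)"
    using assms(2) by (simp add: if_distrib[of "\<lambda>x. of_int x *\<^sub>R _"] cong: if_cong)
  then have "\<exists>n :: nat \<Rightarrow> int. b i = (\<Sum>j<4. of_int (n j) *\<^sub>R b j)"
    by (rule exI[of _ "\<lambda>j. if j = i then 1 else 0"])
  then show ?thesis using assms(1) unfolding oriented_basis_def by auto
qed

text \<open>The factor is an integer because the base change matrix is integral. It does not depend on
  the two forms, so it can be read off from the Kaehler form.\<close>

lemma oriented_basis_change:
  assumes "oriented_basis \<Lambda> b" "oriented_basis \<Lambda> c"
  shows "\<exists>D\<in>\<int>. \<forall>E F. bilinear E \<and> bilinear F \<and> (\<forall>v. E v v = 0 \<and> F v v = 0) \<longrightarrow>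
    wedge E F c = D * wedge E F b"
proof -
  have span: "\<Lambda> = {\<Sum>i<4. of_int (n i) *\<^sub>R b i | n :: nat \<Rightarrow> int. True}"
    using assms by (auto simp: oriented_basis_def)
  have "\<exists>n :: nat \<Rightarrow> int. c i = (\<Sum>j<4. of_int (n j) *\<^sub>R b j)" if "i < 4" for i
    using oriented_basis_mem[OF assms(2) that] by (subst (asm) span) auto
  then obtain n :: "nat \<Rightarrow> nat \<Rightarrow> int" where n: "\<And>i. i < 4 \<Longrightarrow> c i = (\<Sum>j<4. of_int (n i j) *\<^sub>R b j)"
    by metis
  let ?D = "wedge (coord_minor 0 1) (coord_minor 2 3) (\<lambda>i j. of_int (n i j))"
  have "?D \<in> \<int>" by (simp add: wedge_def coord_minor_def)
  then show ?thesis
    by (intro bexI[of _ ?D] allI impI, intro wedge_change_basis) (use n in auto)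
qed

text \<open>The base changes in both directions have integral determinants with product one. Both are
  positive, as both bases are positively oriented, so they equal one.\<close>

lemma intersection_eq_wedge:
  assumes b: "oriented_basis \<Lambda> b" and E: "\<And>v. ev E v v = 0" and F: "\<And>v. ev F v v = 0"
  shows "intersection \<Lambda> E F = wedge (ev E) (ev F) b"
proof -
  define c where "c = (SOME c. oriented_basis \<Lambda> c)"
  have c: "oriented_basis \<Lambda> c" unfolding c_def by (rule someI[of "oriented_basis \<Lambda>", OF b])
  obtain D where D: "D \<in> \<int>"
    "\<And>E F. bilinear E \<Longrightarrow> bilinear F \<Longrightarrow> (\<And>v. E v v = 0 \<and> F v v = 0) \<Longrightarrow> wedge E F c = D * wedge E F b"
    using oriented_basis_change[OF b c] by blast
  obtain D' where D': "D' \<in> \<int>"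
    "\<And>E F. bilinear E \<Longrightarrow> bilinear F \<Longrightarrow> (\<And>v. E v v = 0 \<and> F v v = 0) \<Longrightarrow> wedge E F b = D' * wedge E F c"
    using oriented_basis_change[OF c b] by blast
  let ?k = "wedge kaehler0 kaehler0"
  have k: "?k c = D * ?k b" "?k b = D' * ?k c"
    by (rule D(2) D'(2); simp add: bilinear_kaehler0 kaehler0_self)+
  have pos: "?k b > 0" "?k c > 0" using b c by (auto simp: oriented_basis_def)
  have "D > 0" using k(1) pos by (metis zero_less_mult_pos2)
  have "D' * D = 1" using k pos by (metis mult.assoc mult_cancel_right1 less_irrefl)
  obtain d d' where d: "D = of_int d" "D' = of_int d'" using D(1) D'(1) by (auto elim!: Ints_cases)
  have "d' * d = 1" using \<open>D' * D = 1\<close> unfolding d by (simp flip: of_int_mult)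
  with \<open>D > 0\<close> have "D = 1" using d by (auto simp: zmult_eq_1_iff)
  then have "wedge (ev E) (ev F) c = wedge (ev E) (ev F) b"
    using D(2)[OF bilinear_ev bilinear_ev, of E F] E F by simp
  then show ?thesis by (simp add: intersection_def c_def)
qed

section \<open>The type (1,1) condition\<close>

text \<open>The holomorphic 2-form \<open>dz\<^sub>1 \<and> dz\<^sub>2\<close>, which spans \<open>H\<^sup>2\<^sup>,\<^sup>0\<close>.\<close>

definition dzdz :: "complex^2 \<Rightarrow> complex^2 \<Rightarrow> complex" where
  "dzdz v w = v $ 1 * w $ 2 - v $ 2 * w $ 1"

definition complex_std_basis :: "nat \<Rightarrow> complex^2" where
  "complex_std_basis i = [vector [1, 0], vector [\<i>, 0], vector [0, 1], vector [0, \<i>]] ! i"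

definition real_coord :: "complex^2 \<Rightarrow> nat \<Rightarrow> real" where
  "real_coord v i = [Re (v $ 1), Im (v $ 1), Re (v $ 2), Im (v $ 2)] ! i"

lemma lessThan_4: "{..<4} = {0, 1, 2, 3::nat}" by auto

lemma real_coord_expand: "v = (\<Sum>i<4. real_coord v i *\<^sub>R complex_std_basis i)"
  by (simp add: lessThan_4 vec_eq_iff forall_2 real_coord_def complex_std_basis_def complex_eq_iff)

lemma bilinear_Re_dzdz: "bilinear (\<lambda>v w. Re (dzdz v w))"
  and bilinear_Im_dzdz: "bilinear (\<lambda>v w. Im (dzdz v w))"
  by (auto simp: bilinear_def dzdz_def intro!: linearI simp: algebra_simps)

lemma dzdz_self: "dzdz v v = 0" by (simp add: dzdz_def)

text \<open>Reduces orthogonality of two classes to a computation on the standard real basis of \<open>\<complex>\<^sup>2\<close>.\<close>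

lemma wedge_proportional_to_standard:
  fixes b :: "nat \<Rightarrow> complex^2"
  assumes "wedge kaehler0 kaehler0 b > 0"
  shows "\<exists>D. D \<noteq> 0 \<and> (\<forall>E F. bilinear E \<and> bilinear F \<and> (\<forall>v. E v v = 0 \<and> F v v = 0) \<longrightarrow>
    wedge E F b = D * wedge E F complex_std_basis)"
proof -
  let ?D = "wedge (coord_minor 0 1) (coord_minor 2 3) (\<lambda>i. real_coord (b i))"
  have D: "wedge E F b = ?D * wedge E F complex_std_basis"
    if "bilinear E" "bilinear F" "\<And>v. E v v = 0" "\<And>v. F v v = 0" for E F
    by (rule wedge_change_basis) (use that real_coord_expand in auto)
  moreover have "?D \<noteq> 0"
    using D[OF bilinear_kaehler0 bilinear_kaehler0 kaehler0_self kaehler0_self] assms by auto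
  ultimately show ?thesis by blast
qed

text \<open>The type (1,1) condition as orthogonality to \<open>H\<^sup>2\<^sup>,\<^sup>0\<close>. Written on the standard real basis
  \<open>u\<close>, both conditions say that \<open>E(u\<^sub>0, u\<^sub>2) = E(u\<^sub>1, u\<^sub>3)\<close> and \<open>E(u\<^sub>0, u\<^sub>3) = - E(u\<^sub>1, u\<^sub>2)\<close>.\<close>

lemma i_invariant_iff_wedge_dzdz:
  assumes E: "bilinear E" "\<And>v. E v v = 0" and b: "wedge kaehler0 kaehler0 b > 0"
  shows "(\<forall>v w. E (\<i> *s v) (\<i> *s w) = E v w) \<longleftrightarrow>
    wedge E (\<lambda>v w. Re (dzdz v w)) b = 0 \<and> wedge E (\<lambda>v w. Im (dzdz v w)) b = 0"
proof -
  let ?u = complex_std_basis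
  obtain D where "D \<noteq> 0" and D: "\<And>E F. bilinear E \<Longrightarrow> bilinear F \<Longrightarrow> (\<And>v. E v v = 0 \<and> F v v = 0)
      \<Longrightarrow> wedge E F b = D * wedge E F ?u"
    using wedge_proportional_to_standard[OF b] by blast
  have "wedge E (\<lambda>v w. Re (dzdz v w)) b = D * (E (?u 0) (?u 2) - E (?u 1) (?u 3))"
    by (subst D) (auto simp: E bilinear_Re_dzdz dzdz_self wedge_def,
      auto simp: dzdz_def complex_std_basis_def)
  moreover have "wedge E (\<lambda>v w. Im (dzdz v w)) b = D * (E (?u 0) (?u 3) + E (?u 1) (?u 2))"
    by (subst D) (auto simp: E bilinear_Im_dzdz dzdz_self wedge_def,
      auto simp: dzdz_def complex_std_basis_def)
  moreover have "(\<forall>v w. E (\<i> *s v) (\<i> *s w) = E v w) \<longleftrightarrow>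
    E (?u 0) (?u 2) = E (?u 1) (?u 3) \<and> E (?u 0) (?u 3) = - E (?u 1) (?u 2)" (is "?L \<longleftrightarrow> ?R")
  proof
    assume L: ?L
    have neg: "E v (- w) = - E v w" for v w using bilinear_rneg[OF E(1)] .
    have "\<i> *s ?u 0 = ?u 1" "\<i> *s ?u 2 = ?u 3" "\<i> *s ?u 3 = - ?u 2"
      by (auto simp: complex_std_basis_def vec_eq_iff forall_2)
    then show ?R using L[rule_format, of "?u 0" "?u 2"] L[rule_format, of "?u 0" "?u 3"]
      by (simp add: neg)
  next
    assume R: ?R
    show ?L
    proof (intro allI)
      fix v w
      have expand: "E v w =
        coord_minor 0 1 (real_coord v) (real_coord w) * E (?u 0) (?u 1)
      + coord_minor 0 2 (real_coord v) (real_coord w) * E (?u 0) (?u 2)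
      + coord_minor 0 3 (real_coord v) (real_coord w) * E (?u 0) (?u 3)
      + coord_minor 1 2 (real_coord v) (real_coord w) * E (?u 1) (?u 2)
      + coord_minor 1 3 (real_coord v) (real_coord w) * E (?u 1) (?u 3)
      + coord_minor 2 3 (real_coord v) (real_coord w) * E (?u 2) (?u 3)" for v w
        unfolding coord_minor_def
        by (subst real_coord_expand, subst (2) real_coord_expand, rule alternating_expand[OF E])
      show "E (\<i> *s v) (\<i> *s w) = E v w"
        unfolding expand[of v] expand[of "\<i> *s v"] using R
        by (simp add: coord_minor_def real_coord_def algebra_simps)
    qed
  qed
  ultimately show ?thesis using \<open>D \<noteq> 0\<close> by auto
qed

section \<open>Tori given by a period matrix\<close>

definition torus_lattice :: "complex \<Rightarrow> complex \<Rightarrow> complex \<Rightarrow> complex \<Rightarrow> (complex^2) set" where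
  "torus_lattice m11 m12 m21 m22 = {z. \<exists>k l m n :: int.
     z $ 1 = of_int k + of_int m * m11 + of_int n * m12 \<and>
     z $ 2 = of_int l + of_int m * m21 + of_int n * m22}"

locale period_torus =
  fixes m11 m12 m21 m22 :: complex
  assumes det_Im_pos: "Im m11 * Im m22 - Im m12 * Im m21 > 0"
begin

abbreviation "\<Lambda> \<equiv> torus_lattice m11 m12 m21 m22"

text \<open>Interleaving the columns of the identity and of the period matrix makes the basis positively
  oriented when the imaginary part of the period matrix has positive determinant.\<close>

definition period_basis :: "nat \<Rightarrow> complex^2" where
  "period_basis i = [vector [1, 0], vector [m11, m21], vector [0, 1], vector [m12, m22]] ! i"

lemma oriented_period_basis: "oriented_basis \<Lambda> period_basis"
proof -
  have "z \<in> \<Lambda> \<longleftrightarrow> (\<exists>n::nat\<Rightarrow>int. z = (\<Sum>i<4. of_int (n i) *\<^sub>R period_basis i))" for z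
  proof
    assume "z \<in> \<Lambda>"
    then obtain k l m n :: int where "z $ 1 = of_int k + of_int m * m11 + of_int n * m12"
     "z $ 2 = of_int l + of_int m * m21 + of_int n * m22" by (auto simp: torus_lattice_def)
    then have "z = (\<Sum>i<4. of_int ([k, m, l, n] ! i) *\<^sub>R period_basis i)"
      by (simp add: lessThan_4 vec_eq_iff forall_2 period_basis_def complex_eq_iff)
    then show "\<exists>n::nat\<Rightarrow>int. z = (\<Sum>i<4. of_int (n i) *\<^sub>R period_basis i)" by blast
  next
    assume "\<exists>n::nat\<Rightarrow>int. z = (\<Sum>i<4. of_int (n i) *\<^sub>R period_basis i)"
    then obtain n :: "nat \<Rightarrow> int" where "z = (\<Sum>i<4. of_int (n i) *\<^sub>R period_basis i)" by blast
    then show "z \<in> \<Lambda>" unfolding torus_lattice_def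
      by (intro CollectI exI[of _ "n 0"] exI[of _ "n 1"] exI[of _ "n 2"] exI[of _ "n 3"])
        (simp add: lessThan_4 period_basis_def complex_eq_iff)
  qed
  then have "\<Lambda> = {\<Sum>i<4. of_int (n i) *\<^sub>R period_basis i | n :: nat \<Rightarrow> int. True}" by blast
  moreover have "wedge kaehler0 kaehler0 period_basis > 0"
    using det_Im_pos by (simp add: wedge_def kaehler0_def period_basis_def sum_2 mult.commute)
  ultimately show ?thesis by (simp add: oriented_basis_def)
qed

text \<open>The coordinates of a vector along the columns of the period matrix. They depend only on its
  imaginary part, on which \<open>Im M\<close> is inverted by Cramer's rule.\<close>

definition im_coord1 :: "complex^2 \<Rightarrow> real" where
  "im_coord1 z = (Im m22 * Im (z $ 1) - Im m12 * Im (z $ 2)) / (Im m11 * Im m22 - Im m12 * Im m21)"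

definition im_coord2 :: "complex^2 \<Rightarrow> real" where
  "im_coord2 z = (Im m11 * Im (z $ 2) - Im m21 * Im (z $ 1)) / (Im m11 * Im m22 - Im m12 * Im m21)"

definition period_coord :: "nat \<Rightarrow> complex^2 \<Rightarrow> real" where
  "period_coord i z =
    [Re (z $ 1) - Re m11 * im_coord1 z - Re m12 * im_coord2 z, im_coord1 z,
     Re (z $ 2) - Re m21 * im_coord1 z - Re m22 * im_coord2 z, im_coord2 z] ! i"

lemma im_coords:
  "Im m11 * im_coord1 z + Im m12 * im_coord2 z = Im (z $ 1)"
  "Im m21 * im_coord1 z + Im m22 * im_coord2 z = Im (z $ 2)"
proof -
  let ?d = "Im m11 * Im m22 - Im m12 * Im m21"
  have "Im m11 * (Im m22 * Im (z $ 1) - Im m12 * Im (z $ 2)) +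
      Im m12 * (Im m11 * Im (z $ 2) - Im m21 * Im (z $ 1)) = ?d * Im (z $ 1)"
    "Im m21 * (Im m22 * Im (z $ 1) - Im m12 * Im (z $ 2)) +
      Im m22 * (Im m11 * Im (z $ 2) - Im m21 * Im (z $ 1)) = ?d * Im (z $ 2)"
    by (simp_all add: algebra_simps)
  then show "Im m11 * im_coord1 z + Im m12 * im_coord2 z = Im (z $ 1)"
    "Im m21 * im_coord1 z + Im m22 * im_coord2 z = Im (z $ 2)"
    using det_Im_pos
    by (simp_all only: im_coord1_def im_coord2_def times_divide_eq_right
        add_divide_distrib[symmetric]) simp_all
qed

lemma im_coord_basis:
  "im_coord1 (vector [m11, m21]) = 1" "im_coord2 (vector [m11, m21]) = 0"
  "im_coord1 (vector [m12, m22]) = 0" "im_coord2 (vector [m12, m22]) = 1"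
  using det_Im_pos by (simp_all add: im_coord1_def im_coord2_def mult.commute)

lemma im_coord_real_basis:
  "im_coord1 (vector [1, 0]) = 0" "im_coord2 (vector [1, 0]) = 0"
  "im_coord1 (vector [0, 1]) = 0" "im_coord2 (vector [0, 1]) = 0"
  by (simp_all add: im_coord1_def im_coord2_def)

lemma period_coord_expand: "z = (\<Sum>i<4. period_coord i z *\<^sub>R period_basis i)"
  using im_coords[of z]
  by (simp add: lessThan_4 vec_eq_iff forall_2 period_coord_def period_basis_def complex_eq_iff algebra_simps)

lemma period_coord_basis:
  assumes "i < 4" "j < 4"
  shows "period_coord i (period_basis j) = (if i = j then 1 else 0)"
proof -
  have "i \<in> {0,1,2,3}" "j \<in> {0,1,2,3}" using assms by auto
  then show ?thesis
    by (auto simp: period_coord_def period_basis_def im_coord_basis im_coord_real_basis)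
qed

lemma bounded_linear_period_coord:
  assumes "i < 4" shows "bounded_linear (period_coord i)"
proof -
  have "i \<in> {0,1,2,3}" using assms by auto
  then show ?thesis
    unfolding linear_conv_bounded_linear[symmetric]
    by (auto simp: period_coord_def im_coord1_def im_coord2_def intro!: linearI)
      (simp_all add: algebra_simps add_divide_distrib diff_divide_distrib)
qed

lemma dzdz_period_basis:
  "dzdz (period_basis 0) (period_basis 1) = m21" "dzdz (period_basis 0) (period_basis 2) = 1"
  "dzdz (period_basis 0) (period_basis 3) = m22" "dzdz (period_basis 1) (period_basis 2) = m11"
  "dzdz (period_basis 1) (period_basis 3) = m11 * m22 - m21 * m12"
  "dzdz (period_basis 2) (period_basis 3) = - m12"
  by (simp_all add: dzdz_def period_basis_def)

definition covector :: "nat \<Rightarrow> (complex^2) \<Rightarrow>\<^sub>L real" where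
  "covector i = Blinfun (period_coord i)"

definition tensor :: "nat \<Rightarrow> nat \<Rightarrow> two_form" where
  "tensor i j = blinfun_scaleR_left (covector j) o\<^sub>L covector i"

text \<open>The class with the given values on pairs of elements of the period basis; these six integers
  are its coordinates in the second integral cohomology.\<close>

definition class_of :: "int \<Rightarrow> int \<Rightarrow> int \<Rightarrow> int \<Rightarrow> int \<Rightarrow> int \<Rightarrow> two_form" where
  "class_of e01 e02 e03 e12 e13 e23 =
     of_int e01 *\<^sub>R (tensor 0 1 - tensor 1 0) + of_int e02 *\<^sub>R (tensor 0 2 - tensor 2 0)
   + of_int e03 *\<^sub>R (tensor 0 3 - tensor 3 0) + of_int e12 *\<^sub>R (tensor 1 2 - tensor 2 1)
   + of_int e13 *\<^sub>R (tensor 1 3 - tensor 3 1) + of_int e23 *\<^sub>R (tensor 2 3 - tensor 3 2)"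

lemma ev_tensor:
  assumes "i < 4" "j < 4" shows "ev (tensor i j) v w = period_coord i v * period_coord j w"
  using assms by (simp add: tensor_def covector_def bounded_linear_Blinfun_apply bounded_linear_period_coord
      blinfun.scaleR_left)

lemma ev_class_of:
  "ev (class_of e01 e02 e03 e12 e13 e23) v w =
     of_int e01 * (period_coord 0 v * period_coord 1 w - period_coord 1 v * period_coord 0 w)
   + of_int e02 * (period_coord 0 v * period_coord 2 w - period_coord 2 v * period_coord 0 w)
   + of_int e03 * (period_coord 0 v * period_coord 3 w - period_coord 3 v * period_coord 0 w)
   + of_int e12 * (period_coord 1 v * period_coord 2 w - period_coord 2 v * period_coord 1 w)
   + of_int e13 * (period_coord 1 v * period_coord 3 w - period_coord 3 v * period_coord 1 w)
   + of_int e23 * (period_coord 2 v * period_coord 3 w - period_coord 3 v * period_coord 2 w)"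
  by (simp add: class_of_def blinfun.add_left blinfun.diff_left blinfun.scaleR_left ev_tensor
      del: One_nat_def)

lemma ev_class_of_self: "ev (class_of e01 e02 e03 e12 e13 e23) v v = 0"
  by (simp add: ev_class_of mult.commute)

lemma ev_class_of_basis:
  fixes e01 e02 e03 e12 e13 e23
  defines "E \<equiv> class_of e01 e02 e03 e12 e13 e23"
  shows
  "ev E (period_basis 0) (period_basis 1) = of_int e01" "ev E (period_basis 0) (period_basis 2) = of_int e02"
  "ev E (period_basis 0) (period_basis 3) = of_int e03" "ev E (period_basis 1) (period_basis 2) = of_int e12"
  "ev E (period_basis 1) (period_basis 3) = of_int e13" "ev E (period_basis 2) (period_basis 3) = of_int e23"
  unfolding E_def by (simp_all add: ev_class_of period_coord_basis del: One_nat_def)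

lemma class_of_add:
  "class_of (a1 + b1) (a2 + b2) (a3 + b3) (a4 + b4) (a5 + b5) (a6 + b6) =
   class_of a1 a2 a3 a4 a5 a6 + class_of b1 b2 b3 b4 b5 b6"
  by (simp add: class_of_def scaleR_add_left)

lemma class_of_inject:
  "class_of a1 a2 a3 a4 a5 a6 = class_of b1 b2 b3 b4 b5 b6 \<longleftrightarrow>
   a1 = b1 \<and> a2 = b2 \<and> a3 = b3 \<and> a4 = b4 \<and> a5 = b5 \<and> a6 = b6"
  using ev_class_of_basis[of a1 a2 a3 a4 a5 a6] ev_class_of_basis[of b1 b2 b3 b4 b5 b6]
  by (metis of_int_eq_iff)

lemma class_of_in_H2: "class_of e01 e02 e03 e12 e13 e23 \<in> H2 \<Lambda>"
proof -
  have int: "ev (class_of e01 e02 e03 e12 e13 e23) x y \<in> \<int>" if xy: "x \<in> \<Lambda>" "y \<in> \<Lambda>" for x y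
  proof -
    obtain m n :: "nat \<Rightarrow> int" where "x = (\<Sum>i<4. of_int (m i) *\<^sub>R period_basis i)"
        "y = (\<Sum>i<4. of_int (n i) *\<^sub>R period_basis i)"
      using oriented_period_basis xy unfolding oriented_basis_def by blast
    then show ?thesis
      by (simp only: alternating_expand[OF bilinear_ev ev_class_of_self] ev_class_of_basis)
        (intro Ints_add Ints_mult Ints_diff Ints_of_int)
  qed
  then show ?thesis by (simp add: H2_def ev_class_of_self)
qed

lemma H2_eq_range_class_of:
  assumes "E \<in> H2 \<Lambda>"
  obtains e01 e02 e03 e12 e13 e23 where "E = class_of e01 e02 e03 e12 e13 e23"
proof -
  have basis: "period_basis i \<in> \<Lambda>" if "i < 4" for i
    by (rule oriented_basis_mem[OF oriented_period_basis that])
  have alt: "ev E v v = 0" for v using assms by (simp add: H2_def)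
  have "\<exists>e::int. ev E (period_basis i) (period_basis j) = of_int e" if "i < 4" "j < 4" for i j
    using assms basis[OF that(1)] basis[OF that(2)] unfolding H2_def Ints_def by blast
  then obtain e :: "nat \<Rightarrow> nat \<Rightarrow> int"
    where e: "\<And>i j. i < 4 \<Longrightarrow> j < 4 \<Longrightarrow> ev E (period_basis i) (period_basis j) = of_int (e i j)"
    by metis
  have "ev E v w = ev (class_of (e 0 1) (e 0 2) (e 0 3) (e 1 2) (e 1 3) (e 2 3)) v w" for v w
    by (subst (1 2) period_coord_expand[of v], subst (1 2) period_coord_expand[of w])
      (simp only: alternating_expand[OF bilinear_ev alt] ev_class_of_basis
         alternating_expand[OF bilinear_ev ev_class_of_self],
       simp add: e del: One_nat_def)
  then have "E = class_of (e 0 1) (e 0 2) (e 0 3) (e 1 2) (e 1 3) (e 2 3)"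
    by (intro blinfun_eqI)
  then show thesis by (rule that)
qed

lemma intersection_class_of:
  "intersection \<Lambda> (class_of e01 e02 e03 e12 e13 e23) (class_of f01 f02 f03 f12 f13 f23) =
   of_int (e01 * f23 - e02 * f13 + e03 * f12 + e12 * f03 - e13 * f02 + e23 * f01)"
  by (simp only: intersection_eq_wedge[OF oriented_period_basis ev_class_of_self ev_class_of_self]
      wedge_def ev_class_of_basis) simp

text \<open>The left-hand side of the equation is \<open>E \<and> dz\<^sub>1 \<and> dz\<^sub>2\<close> evaluated on the period basis.\<close>

lemma class_of_in_NS_iff:
  "class_of e01 e02 e03 e12 e13 e23 \<in> NS_set \<Lambda> \<longleftrightarrow>
   - of_int e01 * m12 - of_int e02 * (m11 * m22 - m21 * m12) + of_int e03 * m11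
   + of_int e12 * m22 - of_int e13 + of_int e23 * m21 = 0"
proof -
  let ?E = "class_of e01 e02 e03 e12 e13 e23"
  have pos: "wedge kaehler0 kaehler0 period_basis > 0"
    using oriented_period_basis by (simp add: oriented_basis_def)
  have "?E \<in> NS_set \<Lambda> \<longleftrightarrow> wedge (ev ?E) (\<lambda>v w. Re (dzdz v w)) period_basis = 0 \<and>
      wedge (ev ?E) (\<lambda>v w. Im (dzdz v w)) period_basis = 0"
    using i_invariant_iff_wedge_dzdz[OF bilinear_ev ev_class_of_self pos] class_of_in_H2
    by (simp add: NS_set_def)
  then show ?thesis
    by (simp only: wedge_def ev_class_of_basis dzdz_period_basis) (simp add: complex_eq_iff)
qed

text \<open>Let \<open>D\<close> be the diagonal matrix with entries \<open>\<alpha>, \<beta>\<close>. The third assumption says that \<open>D M\<close> is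
  symmetric, so that the class \<open>E\<close> with matrix \<open>D\<close> between the real and the period part of the
  basis satisfies the Riemann relations: \<open>E(v, i v)\<close> is the sum of the values of the symmetric
  matrix \<open>D (Im M)\<^sup>-\<^sup>1\<close> on the real and the imaginary part of \<open>v\<close>.\<close>

lemma abelian_surface_of_symmetric_period:
  assumes "\<alpha> > 0" "\<beta> > 0" "of_int \<alpha> * m12 = of_int \<beta> * m21" "Im m22 > 0"
  shows "abelian_surface \<Lambda>"
proof -
  let ?E = "class_of \<alpha> 0 0 0 0 \<beta>" and ?d = "Im m11 * Im m22 - Im m12 * Im m21"
  define a b :: real where "a = of_int \<alpha>" and "b = of_int \<beta>"
  have ab: "a > 0" "b > 0" using assms by (auto simp: a_def b_def)
  have sym: "a * Re m12 = b * Re m21" "a * Im m12 = b * Im m21"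
    using assms(3) by (auto simp: a_def b_def complex_eq_iff)
  \<comment> \<open>the quadratic form of \<open>(det Im M) D (Im M)\<^sup>-\<^sup>1\<close>, made symmetric by \<open>sym\<close>\<close>
  define Q where "Q r s = (a * Im m22) * r\<^sup>2 - 2 * (a * Im m12) * r * s + (b * Im m11) * s\<^sup>2" for r s
  have "ev ?E v (\<i> *s v) = (Q (Re (v $ 1)) (Re (v $ 2)) + Q (Im (v $ 1)) (Im (v $ 2))) / ?d" for v
  proof -
    let ?w = "\<i> *s v"
    have y: "?d * im_coord1 v = Im m22 * Im (v $ 1) - Im m12 * Im (v $ 2)"
      "?d * im_coord2 v = Im m11 * Im (v $ 2) - Im m21 * Im (v $ 1)"
      "?d * im_coord1 ?w = Im m22 * Re (v $ 1) - Im m12 * Re (v $ 2)"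
      "?d * im_coord2 ?w = Im m11 * Re (v $ 2) - Im m21 * Re (v $ 1)"
      using det_Im_pos by (simp_all add: im_coord1_def im_coord2_def)
    have "ev ?E v ?w = a * (Re (v $ 1) * im_coord1 ?w + Im (v $ 1) * im_coord1 v)
        + b * (Re (v $ 2) * im_coord2 ?w + Im (v $ 2) * im_coord2 v)
        + (a * Re m12 - b * Re m21) * (im_coord1 v * im_coord2 ?w - im_coord2 v * im_coord1 ?w)"
      by (simp add: ev_class_of period_coord_def a_def b_def algebra_simps)
    then have "?d * ev ?E v ?w = a * (Re (v $ 1) * (?d * im_coord1 ?w) + Im (v $ 1) * (?d * im_coord1 v))
        + b * (Re (v $ 2) * (?d * im_coord2 ?w) + Im (v $ 2) * (?d * im_coord2 v))"
      using sym(1) by (simp add: algebra_simps)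
    also have "\<dots> = Q (Re (v $ 1)) (Re (v $ 2)) + Q (Im (v $ 1)) (Im (v $ 2))
        + (a * Im m12 - b * Im m21) * (Re (v $ 1) * Re (v $ 2) + Im (v $ 1) * Im (v $ 2))"
      unfolding y Q_def by (simp add: algebra_simps power2_eq_square)
    finally show ?thesis using det_Im_pos sym(2) by (simp add: field_simps)
  qed
  moreover have Q_pos: "Q r s > 0" if "r \<noteq> 0 \<or> s \<noteq> 0" for r s
  proof -
    have "(a * Im m22) * (b * Im m11) - (a * Im m12)\<^sup>2 = a * Im m22 * (b * Im m11) - a * Im m12 * (b * Im m21)"
      by (simp add: power2_eq_square flip: sym(2))
    also have "\<dots> = a * b * ?d" by (simp add: algebra_simps)
    also have "\<dots> > 0" using ab det_Im_pos by simp
    finally have "a * Im m22 > 0 \<and> (a * Im m22) * (b * Im m11) > (- (a * Im m12))\<^sup>2"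
      using ab assms(4) by simp
    then show ?thesis
      using binary_form_positive_iff[of "a * Im m22" "- (a * Im m12)" "b * Im m11"] that
      by (simp add: Q_def mult.assoc)
  qed
  moreover have "Q r s \<ge> 0" for r s using Q_pos[of r s] by (cases "r = 0 \<and> s = 0") (auto simp: Q_def)
  moreover have "Re (v $ 1) \<noteq> 0 \<or> Re (v $ 2) \<noteq> 0 \<or> Im (v $ 1) \<noteq> 0 \<or> Im (v $ 2) \<noteq> 0" if "v \<noteq> 0" for v :: "complex^2"
    using that by (auto simp: vec_eq_iff forall_2 complex_eq_iff)
  ultimately have "ev ?E v (\<i> *s v) > 0" if "v \<noteq> 0" for v
    using det_Im_pos that by (metis add_nonneg_pos add_pos_nonneg divide_pos_pos)
  moreover have "?E \<in> NS_set \<Lambda>" using assms(3) by (simp add: class_of_in_NS_iff)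
  ultimately show ?thesis using oriented_period_basis by (auto simp: abelian_surface_def)
qed

end

section \<open>Neron-Severi and transcendental lattices\<close>

context period_torus begin

context
  fixes r s :: int
  assumes coprime_rs: "coprime r s" and rs_nonzero: "r \<noteq> 0" "s \<noteq> 0"
begin

text \<open>The shape of the (1,1) condition on a product of two isogenous elliptic curves without
  complex multiplication: a third class exists besides those of the factors, given by an isogeny
  of degree \<open>\<bar>r s\<bar>\<close>.\<close>

context
  assumes product_type: "\<And>e01 e02 e03 e12 e13 e23.
    class_of e01 e02 e03 e12 e13 e23 \<in> NS_set \<Lambda> \<longleftrightarrow> e02 = 0 \<and> e13 = 0 \<and> e03 * r + e12 * s = 0"
begin

text \<open>The classes with coordinates \<open>e\<^sub>0\<^sub>1\<close> and \<open>e\<^sub>2\<^sub>3\<close> are those of the two factors and span the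
  hyperbolic plane. The class with \<open>(e\<^sub>0\<^sub>3, e\<^sub>1\<^sub>2) = (s, - r)\<close> generates its complement.\<close>

lemma NS_product_type: "lat_iso (lat_sum hyperbolic_lat (rank_one_lat (- 2 * r * s))) (NS \<Lambda>)"
proof (rule lat_iso_parametrization[where f = "\<lambda>((a, b), k). class_of a 0 (k * s) (- k * r) 0 b"])
  fix E assume "E \<in> pts (NS \<Lambda>)"
  then have E: "E \<in> NS_set \<Lambda>" by (simp add: NS_def)
  then have "E \<in> H2 \<Lambda>" by (simp add: NS_set_def)
  then obtain e01 e02 e03 e12 e13 e23 where eq: "E = class_of e01 e02 e03 e12 e13 e23"
    by (rule H2_eq_range_class_of)
  then have e: "e02 = 0" "e13 = 0" "e03 * r = (- e12) * s" using E product_type by auto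
  obtain k where k: "e03 = k * s" "- e12 = k * r"
    using coprime_proportional[OF coprime_rs rs_nonzero(1) e(3)] by blast
  then have "e12 = - k * r" by simp
  with k eq e(1,2) have "E = class_of e01 0 (k * s) (- k * r) 0 e23" by simp
  then show "\<exists>x. E = (\<lambda>((a, b), k). class_of a 0 (k * s) (- k * r) 0 b) x"
    by (intro exI[of _ "((e01, e23), k)"]) simp
qed (auto simp: lat_sum_def hyperbolic_lat_def rank_one_lat_def NS_def product_type class_of_inject
    rs_nonzero class_of_add[symmetric] intersection_class_of algebra_simps)

text \<open>The complement of the two factors has \<open>e\<^sub>0\<^sub>1 = e\<^sub>2\<^sub>3 = 0\<close>. Orthogonality to \<open>(s, - r)\<close> puts
  \<open>(e\<^sub>0\<^sub>3, e\<^sub>1\<^sub>2)\<close> on the line through \<open>(s, r)\<close>. The coordinate \<open>e\<^sub>1\<^sub>3\<close> enters the intersection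
  form with a minus sign, which is absorbed in the parametrization.\<close>

lemma T_product_type: "lat_iso (lat_sum (rank_one_lat (2 * r * s)) hyperbolic_lat) (T \<Lambda>)"
proof (rule lat_iso_parametrization[where f = "\<lambda>(k, u, v). class_of 0 u (k * s) (k * r) (- v) 0"])
  fix E assume "E \<in> pts (T \<Lambda>)"
  then have "E \<in> H2 \<Lambda>" and orth: "\<And>F. F \<in> NS_set \<Lambda> \<Longrightarrow> intersection \<Lambda> E F = 0" by (auto simp: T_def)
  then obtain e01 e02 e03 e12 e13 e23 where eq: "E = class_of e01 e02 e03 e12 e13 e23"
    by (elim H2_eq_range_class_of)
  have "e01 = 0" using orth[of "class_of 0 0 0 0 0 1"]
    by (simp add: product_type eq intersection_class_of)
  moreover have "e23 = 0" using orth[of "class_of 1 0 0 0 0 0"]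
    by (simp add: product_type eq intersection_class_of)
  moreover have "e03 * r = e12 * s" using orth[of "class_of 0 0 s (- r) 0 0"]
    by (simp add: product_type eq intersection_class_of flip: of_int_mult)
  moreover then obtain k where "e03 = k * s" "e12 = k * r"
    using coprime_proportional[OF coprime_rs rs_nonzero(1)] by blast
  ultimately have "E = class_of 0 e02 (k * s) (k * r) (- (- e13)) 0" using eq by simp
  then show "\<exists>x. E = (\<lambda>(k, u, v). class_of 0 u (k * s) (k * r) (- v) 0) x"
    by (intro exI[of _ "(k, e02, - e13)"]) simp
next
  fix x :: "int \<times> int \<times> int"
  obtain k u v where x: "x = (k, u, v)" by (metis surj_pair)
  have "intersection \<Lambda> (class_of 0 u (k * s) (k * r) (- v) 0) F = 0" if F: "F \<in> NS_set \<Lambda>" for F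
  proof -
    have "F \<in> H2 \<Lambda>" using F by (simp add: NS_set_def)
    then obtain f01 f02 f03 f12 f13 f23 where eq: "F = class_of f01 f02 f03 f12 f13 f23"
      by (rule H2_eq_range_class_of)
    then have "f02 = 0" "f13 = 0" and "f03 * r + f12 * s = 0" using F product_type by auto
    moreover have "k * s * f12 + k * r * f03 = k * (f03 * r + f12 * s)" by (simp add: algebra_simps)
    ultimately show ?thesis unfolding eq intersection_class_of by simp
  qed
  then show "(\<lambda>(k, u, v). class_of 0 u (k * s) (k * r) (- v) 0) x \<in> pts (T \<Lambda>)"
    by (simp add: x T_def class_of_in_H2)
qed (auto simp: lat_sum_def hyperbolic_lat_def rank_one_lat_def T_def class_of_inject
    rs_nonzero class_of_add[symmetric] intersection_class_of algebra_simps)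

end

text \<open>The shape of the (1,1) condition on a surface whose only divisor classes are the multiples
  of one class of nonzero square.\<close>

context
  assumes polarized_type: "\<And>e01 e02 e03 e12 e13 e23.
    class_of e01 e02 e03 e12 e13 e23 \<in> NS_set \<Lambda> \<longleftrightarrow>
    e02 = 0 \<and> e03 = 0 \<and> e12 = 0 \<and> e13 = 0 \<and> e01 * r = e23 * s"
begin

text \<open>Coprimality makes \<open>(e\<^sub>0\<^sub>1, e\<^sub>2\<^sub>3) = (s, r)\<close> a generator; for positive \<open>r\<close> and \<open>s\<close> it is the
  primitive polarization.\<close>

lemma NS_polarized_type: "lat_iso (rank_one_lat (2 * r * s)) (NS \<Lambda>)"
proof (rule lat_iso_parametrization[where f = "\<lambda>k. class_of (k * s) 0 0 0 0 (k * r)"])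
  fix E assume "E \<in> pts (NS \<Lambda>)"
  then have E: "E \<in> NS_set \<Lambda>" by (simp add: NS_def)
  then have "E \<in> H2 \<Lambda>" by (simp add: NS_set_def)
  then obtain e01 e02 e03 e12 e13 e23 where eq: "E = class_of e01 e02 e03 e12 e13 e23"
    by (rule H2_eq_range_class_of)
  then have e: "e02 = 0" "e03 = 0" "e12 = 0" "e13 = 0" "e01 * r = e23 * s"
    using E polarized_type by auto
  obtain k where "e01 = k * s" "e23 = k * r"
    using coprime_proportional[OF coprime_rs rs_nonzero(1) e(5)] by blast
  then show "\<exists>k. E = class_of (k * s) 0 0 0 0 (k * r)" using eq e(1-4) by auto
qed (auto simp: rank_one_lat_def NS_def polarized_type class_of_inject
    rs_nonzero class_of_add[symmetric] intersection_class_of algebra_simps)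

text \<open>Orthogonality to the generator leaves \<open>e\<^sub>0\<^sub>2, e\<^sub>1\<^sub>3\<close> and \<open>e\<^sub>0\<^sub>3, e\<^sub>1\<^sub>2\<close> free, which are
  two hyperbolic planes, and puts \<open>(e\<^sub>0\<^sub>1, e\<^sub>2\<^sub>3)\<close> on the line through \<open>(s, - r)\<close>.\<close>

lemma T_polarized_type:
  "lat_iso (lat_sum (lat_sum hyperbolic_lat (rank_one_lat (- 2 * r * s))) hyperbolic_lat) (T \<Lambda>)"
proof (rule lat_iso_parametrization[where
      f = "\<lambda>(((a, b), k), u, v). class_of (k * s) u a b (- v) (- k * r)"])
  fix E assume "E \<in> pts (T \<Lambda>)"
  then have "E \<in> H2 \<Lambda>" and orth: "\<And>F. F \<in> NS_set \<Lambda> \<Longrightarrow> intersection \<Lambda> E F = 0" by (auto simp: T_def)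
  then obtain e01 e02 e03 e12 e13 e23 where eq: "E = class_of e01 e02 e03 e12 e13 e23"
    by (elim H2_eq_range_class_of)
  have "of_int (e01 * r + e23 * s) = (0::real)" using orth[of "class_of s 0 0 0 0 r"]
    by (simp add: polarized_type eq intersection_class_of)
  then have "e01 * r = (- e23) * s" unfolding of_int_eq_0_iff by simp
  then obtain k where k: "e01 = k * s" "- e23 = k * r"
    using coprime_proportional[OF coprime_rs rs_nonzero(1)] by blast
  then have "e23 = - k * r" by simp
  with k eq have "E = class_of (k * s) e02 e03 e12 (- (- e13)) (- k * r)" by simp
  then show "\<exists>x. E = (\<lambda>(((a, b), k), u, v). class_of (k * s) u a b (- v) (- k * r)) x"
    by (intro exI[of _ "(((e03, e12), k), e02, - e13)"]) simp
next
  fix x :: "((int \<times> int) \<times> int) \<times> int \<times> int"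
  obtain a b k u v where x: "x = (((a, b), k), u, v)" by (metis surj_pair)
  have "intersection \<Lambda> (class_of (k * s) u a b (- v) (- k * r)) F = 0" if F: "F \<in> NS_set \<Lambda>" for F
  proof -
    have "F \<in> H2 \<Lambda>" using F by (simp add: NS_set_def)
    then obtain f01 f02 f03 f12 f13 f23 where eq: "F = class_of f01 f02 f03 f12 f13 f23"
      by (rule H2_eq_range_class_of)
    then have "f02 = 0" "f03 = 0" "f12 = 0" "f13 = 0" and "f01 * r = f23 * s"
      using F polarized_type by auto
    then show ?thesis
      unfolding eq intersection_class_of of_int_eq_0_iff by (simp add: mult.commute)
  qed
  then show "(\<lambda>(((a, b), k), u, v). class_of (k * s) u a b (- v) (- k * r)) x \<in> pts (T \<Lambda>)"
    by (simp add: x T_def class_of_in_H2)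
qed (auto simp: lat_sum_def hyperbolic_lat_def rank_one_lat_def T_def class_of_inject
    rs_nonzero class_of_add[symmetric] intersection_class_of algebra_simps)

end
end
end

section \<open>Period lattices of the fibers and of the mirror base\<close>

lemma exp_2pi_i_eq_iff:
  "exp (2 * of_real pi * \<i> * z) = exp (2 * of_real pi * \<i> * w) \<longleftrightarrow> (\<exists>k::int. z = of_int k + w)"
proof -
  have "exp (2 * of_real pi * \<i> * z) = exp (2 * of_real pi * \<i> * w) \<longleftrightarrow>
      (\<exists>k::int. 2 * of_real pi * \<i> * z = 2 * of_real pi * \<i> * (of_int k + w))"
    unfolding exp_eq by (simp add: algebra_simps)
  then show ?thesis by simp
qed

lemma period_lattice_exp:
  "period_lattice {(exp (2 * of_real pi * \<i> * (of_int m * m11 + of_int n * m12)),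
      exp (2 * of_real pi * \<i> * (of_int m * m21 + of_int n * m22))) | m n :: int. True}
   = torus_lattice m11 m12 m21 m22"
  unfolding period_lattice_def torus_lattice_def
  by (auto simp: exp_2pi_i_eq_iff) (metis add.assoc)+

text \<open>Writing \<open>t\<close> as an exponential turns the multiplicative periods into additive ones.\<close>

lemma X_fiber_exp:
  "X_fiber p q (exp (2 * of_real pi * \<i> * s)) = torus_lattice (of_nat p * s) 0 0 (of_nat q * s)"
  unfolding X_fiber_def period_lattice_exp[symmetric]
  by (simp add: exp_power_int[symmetric] exp_power_int mult_ac)

lemma A_base_eq_torus_lattice:
  "A_base p q \<tau> \<sigma> \<rho> = torus_lattice \<tau> (\<sigma> / of_nat q) (\<sigma> / of_nat p) \<rho>"
  unfolding A_base_def period_lattice_exp[symmetric]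
  by (simp add: exp_power_int algebra_simps flip: exp_add)

section \<open>Genericity\<close>

text \<open>Rational \<open>s\<close> are included; for \<open>s\<close> in the upper half-plane these are the values for which
  the elliptic curve with period \<open>s\<close> has complex multiplication.\<close>

definition quadratic_numbers :: "complex set" where
  "quadratic_numbers = {s. \<exists>A B C :: int. (A \<noteq> 0 \<or> B \<noteq> 0 \<or> C \<noteq> 0) \<and>
     of_int A * s\<^sup>2 + of_int B * s + of_int C = 0}"

lemma countable_quadratic_numbers: "countable quadratic_numbers"
proof -
  have "finite {s :: complex. of_int A * s\<^sup>2 + of_int B * s + of_int C = 0}"
    if "A \<noteq> 0 \<or> B \<noteq> 0 \<or> C \<noteq> 0" for A B C :: int
  proof -
    have "finite {s :: complex. poly [:of_int C, of_int B, of_int A:] s = 0}"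
      using that by (intro poly_roots_finite) auto
    then show ?thesis by (simp add: algebra_simps power2_eq_square)
  qed
  then have "countable (\<Union>(A, B, C) \<in> {(A, B, C). A \<noteq> 0 \<or> B \<noteq> 0 \<or> C \<noteq> 0}.
      {s :: complex. of_int A * s\<^sup>2 + of_int B * s + of_int (C :: int) = 0})"
    by (intro countable_UN) (auto intro: countable_finite)
  then show ?thesis by (rule countable_subset[rotated]) (auto simp: quadratic_numbers_def)
qed

text \<open>The integral combinations of \<open>1, \<tau>, \<sigma>, \<rho>\<close> and the determinant of the period matrix, known as
  Humbert's singular relations.\<close>

definition singular_relation :: "nat \<Rightarrow> nat \<Rightarrow> int \<times> int \<times> int \<times> int \<times> int \<Rightarrow> complex^3 \<Rightarrow> complex" where
  "singular_relation p q k x = (case k of (k0, k1, k2, k3, k4) \<Rightarrow>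
     of_int k0 + of_int k1 * x $ 1 + of_int k2 * x $ 2 + of_int k3 * x $ 3
     + of_int k4 * (of_nat (p * q) * (x $ 1 * x $ 3) - (x $ 2)\<^sup>2))"

lemma period_domain_iff:
  assumes "p \<ge> 1" "q \<ge> 1"
  shows "x \<in> period_domain p q \<longleftrightarrow>
    Im (x $ 1) > 0 \<and> real (p * q) * (Im (x $ 1) * Im (x $ 3)) > (Im (x $ 2))\<^sup>2"
proof -
  have "transpose (period_matrix p q x) = period_matrix p q x"
    by (simp add: transpose_def period_matrix_def vec_eq_iff forall_2)
  then have "x \<in> period_domain p q \<longleftrightarrow>
      (\<forall>r s. (vector [r, s] :: real^2) \<noteq> 0 \<longrightarrow> (vector [r, s] :: real^2)
        \<bullet> ((\<chi> i j. Im (period_matrix p q x $ i $ j)) *v vector [r, s]) > 0)"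
    by (simp add: period_domain_def siegel_upper_half_def forall_vector_2)
  also have "\<dots> \<longleftrightarrow> (\<forall>r s. r \<noteq> 0 \<or> s \<noteq> 0 \<longrightarrow>
      real p * Im (x $ 1) * r\<^sup>2 + 2 * Im (x $ 2) * r * s + real q * Im (x $ 3) * s\<^sup>2 > 0)"
    by (simp add: vec_eq_iff forall_2 inner_vec_def matrix_vector_mult_def sum_2 period_matrix_def
        algebra_simps power2_eq_square)
  also have "\<dots> \<longleftrightarrow> Im (x $ 1) > 0 \<and> real (p * q) * (Im (x $ 1) * Im (x $ 3)) > (Im (x $ 2))\<^sup>2"
    unfolding binary_form_positive_iff using assms by (simp add: mult_ac zero_less_mult_iff)
  finally show ?thesis .
qed

lemma open_period_domain:
  assumes "p \<ge> 1" "q \<ge> 1" shows "open (period_domain p q)"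
proof -
  have "period_domain p q = {x. Im (x $ 1) > 0} \<inter>
     {x. real (p * q) * (Im (x $ 1) * Im (x $ 3)) > (Im (x $ 2))\<^sup>2}"
    using period_domain_iff[OF assms] by auto
  then show ?thesis by (auto intro!: open_Int open_Collect_less continuous_intros)
qed

lemma holomorphic_singular_relation: "holomorphic_several (singular_relation p q k) S"
proof -
  obtain k0 k1 k2 k3 k4 where k: "k = (k0, k1, k2, k3, k4)" by (metis surj_pair)
  show ?thesis unfolding holomorphic_several_def
  proof (intro ballI exI conjI allI)
    fix x :: "complex^3"
    let ?D = "\<lambda>v. of_int k1 * v $ 1 + of_int k2 * v $ 2 + of_int k3 * v $ 3 +
      of_int k4 * (of_nat (p * q) * (x $ 1 * v $ 3 + v $ 1 * x $ 3) - 2 * x $ 2 * v $ 2)"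
    have nth: "((\<lambda>x. x $ i) has_derivative (\<lambda>v. v $ i)) (at x)" for i
      by (rule bounded_linear_imp_has_derivative[OF bounded_linear_vec_nth])
    show "(singular_relation p q k has_derivative ?D) (at x)"
      unfolding singular_relation_def k prod.case
      by (rule derivative_eq_intros nth refl | simp)+ (simp add: fun_eq_iff algebra_simps)
    show "?D (c *s v) = c * ?D v" for c v by (simp add: algebra_simps)
  qed
qed

text \<open>On the points \<open>(i a, u, i b)\<close> with \<open>a, b > 0\<close> and \<open>u\<close> real the real and imaginary parts
  separate, and a few values of \<open>a\<close>, \<open>b\<close> and \<open>u\<close> determine all coefficients.\<close>

lemma singular_relation_nontrivial:
  assumes "p \<ge> 1" "q \<ge> 1" and k: "k \<noteq> 0"
  shows "\<exists>x\<in>period_domain p q. singular_relation p q k x \<noteq> 0"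
proof (rule ccontr)
  assume *: "\<not> ?thesis"
  obtain k0 k1 k2 k3 k4 where k': "k = (k0, k1, k2, k3, k4)" by (metis surj_pair)
  define n where "n = real (p * q)"
  have "n > 0" using assms by (simp add: n_def)
  have eq: "of_int k1 * a + of_int k3 * b = 0 \<and> of_int k0 + of_int k2 * u - of_int k4 * (n * (a * b) + u\<^sup>2) = 0"
    if "a > 0" "b > 0" for a b u :: real
  proof -
    let ?x = "vector [\<i> * of_real a, of_real u, \<i> * of_real b] :: complex^3"
    have "?x \<in> period_domain p q" using that \<open>n > 0\<close>
      by (simp add: period_domain_iff[OF assms(1,2)] n_def)
    then have "singular_relation p q k ?x = 0" using * by blast
    then show ?thesis unfolding singular_relation_def k' n_def
      by (simp add: complex_eq_iff algebra_simps power2_eq_square)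
  qed
  have "k1 = 0 \<and> k3 = 0" using eq[of 1 1 0] eq[of 1 2 0] by simp
  moreover have "k4 = 0" using eq[of 1 1 0] eq[of 1 2 0] \<open>n > 0\<close> by auto
  moreover then have "k0 = 0 \<and> k2 = 0" using eq[of 1 1 0] eq[of 1 1 1] by simp
  ultimately show False using k k' by (simp add: zero_prod_def)
qed

definition singular_locus :: "nat \<Rightarrow> nat \<Rightarrow> (complex^3) set" where
  "singular_locus p q = \<Union>((\<lambda>k. {x \<in> period_domain p q. singular_relation p q k x = 0}) ` {k. k \<noteq> 0})"

lemma exceptional_singular_locus:
  assumes "p \<ge> 1" "q \<ge> 1" shows "exceptional_set (period_domain p q) (singular_locus p q)"
proof -
  let ?S = "period_domain p q" and ?W = "\<lambda>k. {x \<in> period_domain p q. singular_relation p q k x = 0}"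
  have "analytic_subset ?S (?W k)" for k
    unfolding analytic_subset_def
    by (intro conjI ballI exI[of _ ?S] exI[of _ "{singular_relation p q k}"])
      (auto simp: open_period_domain[OF assms] holomorphic_singular_relation)
  moreover have "?W k \<noteq> ?S" if "k \<noteq> 0" for k
    using singular_relation_nontrivial[OF assms that] by blast
  ultimately show ?thesis
    unfolding exceptional_set_def singular_locus_def
    by (intro exI[of _ "?W ` {k. k \<noteq> 0}"]) (auto intro: countable_image)
qed

section \<open>The parameters of the mirror lie in the period domain\<close>

lemma sum_periodic_shift:
  fixes f :: "int \<Rightarrow> 'a::comm_monoid_add"
  assumes "\<And>a. f (a + int p) = f a"
  shows "(\<Sum>k<p. f (int k - 1)) = (\<Sum>k<p. f (int k))"
proof (cases p)
  case (Suc n)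
  have "f (- 1) = f (int n)" using assms[of "- 1"] by (simp add: Suc)
  then show ?thesis unfolding Suc sum.lessThan_Suc_shift[of "\<lambda>k. f (int k - 1)"]
    by (simp add: add.commute)
qed simp

text \<open>The toric relation at the vertices of a row, summed over a period, says that consecutive
  rows have the same sum.\<close>

lemma tau_param_const:
  assumes per: "\<And>a b. c1 (a + int p) b = c1 a b"
    and rel: "\<And>a b. c2 a b + c1 (a - 1) b = c2 a (b - 1) + c1 a (b - 1)"
  shows "tau_param p c1 c2 b = tau_param p c1 c2 0"
proof -
  have step: "tau_param p c1 c2 b = tau_param p c1 c2 (b - 1)" for b
  proof -
    have "tau_param p c1 c2 b = (\<Sum>k<p. c2 (int k) b + c1 (int k - 1) b)"
      using sum_periodic_shift[of "\<lambda>a. c1 a b" p] per by (simp add: tau_param_def sum.distrib add.commute)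
    also have "\<dots> = tau_param p c1 c2 (b - 1)"
      unfolding rel by (simp add: tau_param_def add.commute)
    finally show ?thesis .
  qed
  show ?thesis
  proof (induction b rule: int_induct[where k = 0])
    case (step1 i) then show ?case using step[of "i + 1"] by simp
  next
    case (step2 i) then show ?case using step[of i] by simp
  qed simp
qed

text \<open>Summing over all rows, \<open>q \<tau>\<close> is the sum of all \<open>c1\<close> and all \<open>c2\<close>, and the latter have
  positive imaginary part.\<close>

lemma Im_tau_param_gt:
  assumes "p \<ge> 1" "q \<ge> 1" and pos: "\<And>a b. Im (c2 a b) > 0"
    and per: "\<And>a b. c1 (a + int p) b = c1 a b"
    and rel: "\<And>a b. c2 a b + c1 (a - 1) b = c2 a (b - 1) + c1 a (b - 1)"
  shows "real q * Im (tau_param p c1 c2 b) > (\<Sum>k<p. \<Sum>l<q. Im (c1 (int k) (int l)))"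
proof -
  have "tau_param p c1 c2 (int l) = tau_param p c1 c2 b" for l
    using tau_param_const[of c1 p c2, OF per rel] by metis
  then have "real q * Im (tau_param p c1 c2 b) = (\<Sum>l<q. Im (tau_param p c1 c2 (int l)))"
    by simp
  also have "\<dots> = (\<Sum>l<q. \<Sum>k<p. Im (c1 (int k) (int l))) + (\<Sum>l<q. \<Sum>k<p. Im (c2 (int k) (int l)))"
    by (simp add: tau_param_def sum.distrib)
  also have "\<dots> > (\<Sum>l<q. \<Sum>k<p. Im (c1 (int k) (int l)))"
    using assms(1,2) pos by (auto intro!: sum_pos simp: lessThan_empty_iff)
  finally show ?thesis by (subst sum.swap)
qed

text \<open>Exchanging the two directions turns \<open>\<rho>\<close> into \<open>\<tau>\<close>, so \<open>q Im \<tau>\<close> and \<open>p Im \<rho>\<close> both exceed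
  \<open>Im \<sigma>\<close>.\<close>

lemma kaehler_parameters_in_period_domain:
  assumes "p \<ge> 1" "q \<ge> 1" and kp: "kaehler_parameters p q c1 c2 c3"
  shows "vector [tau_param p c1 c2 b, sigma_param p q c1, rho_param q c1 c3 a] \<in> period_domain p q"
proof -
  have per: "\<And>a b. c1 (a + int p) b = c1 a b" "\<And>a b. c1 a (b + int q) = c1 a b"
    and pos: "\<And>a b. Im (c1 a b) > 0" "\<And>a b. Im (c2 a b) > 0" "\<And>a b. Im (c3 a b) > 0"
    and rel: "\<And>a b. c3 a b + c1 a (b - 1) = c3 (a - 1) b + c1 (a - 1) b"
      "\<And>a b. c2 a b + c1 (a - 1) b = c2 a (b - 1) + c1 a (b - 1)"
    using kp unfolding kaehler_parameters_def by auto
  let ?t = "Im (tau_param p c1 c2 b)" and ?s = "Im (sigma_param p q c1)" and ?r = "Im (rho_param q c1 c3 a)"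
  have s: "?s = (\<Sum>k<p. \<Sum>l<q. Im (c1 (int k) (int l)))" by (simp add: sigma_param_def)
  have "?s > 0" unfolding s using assms(1,2) pos(1) by (auto intro!: sum_pos simp: lessThan_empty_iff)
  have t: "real q * ?t > ?s"
    unfolding s by (rule Im_tau_param_gt) (use assms(1,2) per(1) pos(2) rel(2) in auto)
  have "rho_param q c1 c3 a = tau_param q (\<lambda>x y. c1 y x) (\<lambda>x y. c3 y x) a"
    by (simp add: rho_param_def tau_param_def)
  moreover have "real p * Im (tau_param q (\<lambda>x y. c1 y x) (\<lambda>x y. c3 y x) a) >
      (\<Sum>k<q. \<Sum>l<p. Im (c1 (int l) (int k)))"
    by (rule Im_tau_param_gt) (use assms(1,2) per(2) pos(3) rel(1) in auto)
  ultimately have r: "real p * ?r > ?s" unfolding s by (subst sum.swap) simp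
  have "?s * ?s < (real q * ?t) * (real p * ?r)"
    using t r \<open>?s > 0\<close> by (intro mult_strict_mono) auto
  moreover have "?t > 0" using t \<open>?s > 0\<close> assms(2) by (simp add: zero_less_mult_iff) (smt (verit) zero_less_mult_iff of_nat_0_le_iff)
  ultimately show ?thesis
    by (simp add: period_domain_iff[OF assms(1,2)] power2_eq_square mult_ac)
qed

section \<open>Mirror symmetry\<close>

text \<open>The (1,1) condition is a quadratic equation for \<open>s\<close> with integral coefficients, all of which
  vanish because \<open>s\<close> is not a quadratic number.\<close>

lemma product_type_of_generic:
  fixes p q :: nat and g r r' :: int
  assumes "p \<ge> 1" "q \<ge> 1" and pq: "int p = g * r" "int q = g * r'"
    and rs: "g > 0" "r > 0" "r' > 0" "coprime r r'"
    and Im_s: "Im s > 0" and generic: "s \<notin> quadratic_numbers"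
  shows "abelian_surface (torus_lattice (of_nat p * s) 0 0 (of_nat q * s))"
    and "lat_iso (lat_sum hyperbolic_lat (rank_one_lat (- 2 * r * r'))) (NS (torus_lattice (of_nat p * s) 0 0 (of_nat q * s)))"
    and "lat_iso (lat_sum (rank_one_lat (2 * r * r')) hyperbolic_lat) (T (torus_lattice (of_nat p * s) 0 0 (of_nat q * s)))"
proof -
  interpret period_torus "of_nat p * s" 0 0 "of_nat q * s"
    by unfold_locales (use assms(1,2) Im_s in simp)
  have nonzero: "r \<noteq> 0" "r' \<noteq> 0" using rs by simp_all
  show "abelian_surface \<Lambda>"
    by (rule abelian_surface_of_symmetric_period[of 1 1]) (use assms(1,2) Im_s in simp_all)
  have independent: "A = 0 \<and> B = 0 \<and> C = 0"
    if "of_int A * s\<^sup>2 + of_int B * s + of_int C = 0" for A B C :: int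
    using generic that unfolding quadratic_numbers_def by blast
  have NS_iff: "class_of e01 e02 e03 e12 e13 e23 \<in> NS_set \<Lambda> \<longleftrightarrow> e02 = 0 \<and> e13 = 0 \<and> e03 * r + e12 * r' = 0"
    for e01 e02 e03 e12 e13 e23
  proof -
    have "class_of e01 e02 e03 e12 e13 e23 \<in> NS_set \<Lambda> \<longleftrightarrow>
        of_int (- (e02 * int p * int q)) * s\<^sup>2 + of_int (e03 * int p + e12 * int q) * s + of_int (- e13) = 0"
      unfolding class_of_in_NS_iff by (simp add: algebra_simps power2_eq_square)
    also have "\<dots> \<longleftrightarrow> - (e02 * int p * int q) = 0 \<and> e03 * int p + e12 * int q = 0 \<and> - e13 = 0"
      using independent[of "- (e02 * int p * int q)" "e03 * int p + e12 * int q" "- e13"]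
      by (metis add_0 mult_zero_left of_int_0)
    also have "e03 * int p + e12 * int q = g * (e03 * r + e12 * r')"
      unfolding pq by (simp add: algebra_simps)
    finally show ?thesis using assms(1,2) rs(1) by auto
  qed
  show "lat_iso (lat_sum hyperbolic_lat (rank_one_lat (- 2 * r * r'))) (NS \<Lambda>)"
    by (rule NS_product_type[OF rs(4) nonzero NS_iff])
  show "lat_iso (lat_sum (rank_one_lat (2 * r * r')) hyperbolic_lat) (T \<Lambda>)"
    by (rule T_product_type[OF rs(4) nonzero NS_iff])
qed

text \<open>Multiplied by \<open>p q\<close>, the (1,1) condition is a singular relation. Outside the singular locus
  all its coefficients vanish.\<close>

lemma polarized_type_of_generic:
  fixes p q :: nat and x :: "complex^3" and g r r' :: int
  assumes "p \<ge> 1" "q \<ge> 1" and pq: "int p = g * r" "int q = g * r'"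
    and rs: "g > 0" "r > 0" "r' > 0" "coprime r r'"
    and x: "x \<in> period_domain p q" "x \<notin> singular_locus p q"
  defines "\<Lambda> \<equiv> torus_lattice (x $ 1) (x $ 2 / of_nat q) (x $ 2 / of_nat p) (x $ 3)"
  shows "abelian_surface \<Lambda>"
    and "lat_iso (rank_one_lat (2 * r * r')) (NS \<Lambda>)"
    and "lat_iso (lat_sum (lat_sum hyperbolic_lat (rank_one_lat (- 2 * r * r'))) hyperbolic_lat) (T \<Lambda>)"
proof -
  have dom: "Im (x $ 1) > 0" "real (p * q) * (Im (x $ 1) * Im (x $ 3)) > (Im (x $ 2))\<^sup>2"
    using x(1) by (auto simp: period_domain_iff[OF assms(1,2)])
  have "real (p * q) > 0" using assms(1,2) by simp
  then have det: "Im (x $ 1) * Im (x $ 3) > (Im (x $ 2))\<^sup>2 / real (p * q)"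
    using dom(2) by (simp add: divide_less_eq mult.commute)
  interpret period_torus "x $ 1" "x $ 2 / of_nat q" "x $ 2 / of_nat p" "x $ 3"
    by unfold_locales (use det in \<open>simp add: power2_eq_square mult.commute\<close>)
  have "Im (x $ 3) > 0"
  proof -
    have "Im (x $ 1) * Im (x $ 3) > 0" using det by (smt (verit) divide_nonneg_nonneg of_nat_0_le_iff zero_le_power2)
    then show ?thesis using dom(1) by (simp add: zero_less_mult_iff)
  qed
  have complex_pq: "of_nat p = of_int g * (of_int r :: complex)" "of_nat q = of_int g * (of_int r' :: complex)"
    using arg_cong[OF pq(1), of "of_int :: int \<Rightarrow> complex"] arg_cong[OF pq(2), of "of_int :: int \<Rightarrow> complex"] by simp_all
  have nonzero: "r \<noteq> 0" "r' \<noteq> 0" using rs by simp_all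
  show "abelian_surface \<Lambda>" unfolding \<Lambda>_def
    by (rule abelian_surface_of_symmetric_period[of r' r])
      (use rs \<open>Im (x $ 3) > 0\<close> in \<open>auto simp: complex_pq\<close>)
  have NS_iff: "class_of e01 e02 e03 e12 e13 e23 \<in> NS_set \<Lambda> \<longleftrightarrow>
      e02 = 0 \<and> e03 = 0 \<and> e12 = 0 \<and> e13 = 0 \<and> e01 * r = e23 * r'" for e01 e02 e03 e12 e13 e23
  proof -
    \<comment> \<open>the coefficients of the (1,1) condition after clearing denominators\<close>
    let ?k = "(- (int (p * q) * e13), int (p * q) * e03, e23 * int q - e01 * int p, int (p * q) * e12, - e02)"
    let ?l = "- of_int e01 * (x $ 2 / of_nat q) - of_int e02 * (x $ 1 * x $ 3 - x $ 2 / of_nat p * (x $ 2 / of_nat q))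
       + of_int e03 * x $ 1 + of_int e12 * x $ 3 - of_int e13 + of_int e23 * (x $ 2 / of_nat p)"
    have "of_nat (p * q) * ?l = singular_relation p q ?k x"
      using assms(1,2) by (simp add: singular_relation_def field_simps power2_eq_square)
    then have "class_of e01 e02 e03 e12 e13 e23 \<in> NS_set \<Lambda> \<longleftrightarrow> singular_relation p q ?k x = 0"
      unfolding \<Lambda>_def class_of_in_NS_iff using assms(1,2) by (metis mult_eq_0_iff of_nat_eq_0_iff not_one_le_zero)
    also have "\<dots> \<longleftrightarrow> ?k = 0"
    proof
      assume "singular_relation p q ?k x = 0"
      then show "?k = 0" using x unfolding singular_locus_def by blast
    qed (use assms(1,2) in \<open>auto simp: singular_relation_def zero_prod_def\<close>)
    also have "e23 * int q - e01 * int p = g * (e23 * r' - e01 * r)"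
      using pq by (simp add: algebra_simps)
    finally show ?thesis using assms(1,2) rs(1) by (auto simp: zero_prod_def)
  qed
  show "lat_iso (rank_one_lat (2 * r * r')) (NS \<Lambda>)"
    unfolding \<Lambda>_def by (rule NS_polarized_type[OF rs(4) nonzero NS_iff[unfolded \<Lambda>_def]])
  show "lat_iso (lat_sum (lat_sum hyperbolic_lat (rank_one_lat (- 2 * r * r'))) hyperbolic_lat) (T \<Lambda>)"
    unfolding \<Lambda>_def by (rule T_polarized_type[OF rs(4) nonzero NS_iff[unfolded \<Lambda>_def]])
qed

theorem proposition5p12:
  fixes p q :: nat
  assumes "p \<ge> 1" and "q \<ge> 1"
  shows "\<exists>N Z. countable N \<and> exceptional_set (period_domain p q) Z \<and>
    (\<forall>t c1 c2 c3 a b.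
       0 < norm t \<and> norm t < 1 \<and> t \<notin> N \<and> kaehler_parameters p q c1 c2 c3 \<and>
       vector [tau_param p c1 c2 b, sigma_param p q c1, rho_param q c1 c3 a] \<notin> Z \<longrightarrow>
       mirror_symmetric (X_fiber p q t)
         (A_base p q (tau_param p c1 c2 b) (sigma_param p q c1) (rho_param q c1 c3 a)))"
proof (intro exI conjI allI impI)
  show "countable ((\<lambda>s. exp (2 * of_real pi * \<i> * s)) ` quadratic_numbers)"
    by (intro countable_image countable_quadratic_numbers)
  show "exceptional_set (period_domain p q) (singular_locus p q)"
    by (rule exceptional_singular_locus[OF assms])
  fix t c1 c2 c3 a b
  let ?x = "vector [tau_param p c1 c2 b, sigma_param p q c1, rho_param q c1 c3 a] :: complex^3"
  assume *: "0 < norm t \<and> norm t < 1 \<and> t \<notin> (\<lambda>s. exp (2 * of_real pi * \<i> * s)) ` quadratic_numbers \<and>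
      kaehler_parameters p q c1 c2 c3 \<and> ?x \<notin> singular_locus p q"
  define s where "s = Ln t / (2 * of_real pi * \<i>)"
  have t: "t = exp (2 * of_real pi * \<i> * s)" using * by (simp add: s_def)
  have Im_s: "Im s > 0"
  proof -
    have "norm t = exp (- (2 * pi * Im s))" unfolding t by (simp add: norm_exp_eq_Re)
    then show ?thesis using * by (simp add: zero_less_mult_iff)
  qed
  have generic: "s \<notin> quadratic_numbers" using * t by blast
  have X: "X_fiber p q t = torus_lattice (of_nat p * s) 0 0 (of_nat q * s)"
    unfolding t by (rule X_fiber_exp)
  have A: "A_base p q (tau_param p c1 c2 b) (sigma_param p q c1) (rho_param q c1 c3 a) =
      torus_lattice (?x $ 1) (?x $ 2 / of_nat q) (?x $ 2 / of_nat p) (?x $ 3)"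
    by (simp add: A_base_eq_torus_lattice)
  have x: "?x \<in> period_domain p q" "?x \<notin> singular_locus p q"
    using kaehler_parameters_in_period_domain[OF assms] * by blast+
  obtain g r r' where gr: "int p = g * r" "int q = g * r'" "g > 0" "r > 0" "r' > 0" "coprime r r'"
    using gcd_cofactors[OF assms] .
  note product = product_type_of_generic[OF assms gr Im_s generic]
  note polarized = polarized_type_of_generic[OF assms gr x]
  show "mirror_symmetric (X_fiber p q t)
      (A_base p q (tau_param p c1 c2 b) (sigma_param p q c1) (rho_param q c1 c3 a))"
    unfolding mirror_symmetric_def X A
    by (intro conjI product(1) polarized(1)
        lat_iso_sum_substitute[OF product(2) _ polarized(3)]
        lat_iso_sum_substitute[OF polarized(2) _ product(3)])
      (simp_all add: lat_sum_def hyperbolic_lat_def rank_one_lat_def)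
qed

end
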